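(* For an alphabet $\Sigma=\{\sigma_1,\dots,\sigma_k\}$ of size $k\ge 2$, let $r_{k,n}$ be the number of expressions of size $n$ in $\mathrm{RE}_{na}$ and $t_{k,n}$ the total number of transitions of the Glushkov automata of all expressions of size $n$ in $\mathrm{RE}_{na}$. Then for each $k$ there is a constant $\lambda_k$ such that $\frac{t_{k,n}}{r_{k,n}}\sim \lambda_k\, n$ as $n\to\infty$, and $\lim_{k\to\infty}\lambda_k=1$.
   Context: Regular expressions over $\Sigma$ are generated by $\beta := \varepsilon \mid \sigma\ (\sigma\in\Sigma) \mid (\beta+\beta) \mid (\beta\cdot\beta) \mid (\beta^\star)$ (the empty-set expression is not counted). The size $|\beta|$ is the number of occurrences of the symbols $\varepsilon$, letters, $+$, $\cdot$, $\star$ in $\beta$ (parentheses not counted). A $\Sigma$-star expression is an expression $(\tau^\star)$ where $\tau$ is a fully parenthesized union of the $k$ letters, each occurring exactly once, in any order and any bracketing. $\mathrm{RE}_{na}$ is the set of regular expressions having no subexpression $(\beta_1+\beta_2)$ in which $\beta_1$ or $\beta_2$ is a $\Sigma$-star expression. Glushkov automaton: number the letter occurrences of $\beta$ from left to right as positions $1,\dots,|\beta|_\Sigma$, and let $\overline\beta$ be $\beta$ with each letter marked by its position. Let $\mathrm{First}(\beta)$ be the set of positions $i$ such that some word of $\mathcal L(\overline\beta)$ begins with the letter marked $i$, $\mathrm{Last}(\beta)$ the set of positions $i$ such that some word of $\mathcal L(\overline\beta)$ ends with the letter marked $i$, and $\mathrm{Follow}(\beta)$ the set of pairs $(i,j)$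 such that some word of $\mathcal L(\overline\beta)$ contains the letter marked $i$ immediately followed by the letter marked $j$. The Glushkov automaton of $\beta$ has states $\{0,1,\dots,|\beta|_\Sigma\}$, initial state $0$, transitions $(0,\sigma_j,j)$ for $j\in\mathrm{First}(\beta)$ and $(i,\sigma_j,j)$ for $(i,j)\in\mathrm{Follow}(\beta)$ (where $\sigma_j$ is the letter at position $j$), and final states $\mathrm{Last}(\beta)$, together with $0$ if $\varepsilon\in\mathcal L(\beta)$. Thus its number of transitions is $|\mathrm{First}(\beta)|+|\mathrm{Follow}(\beta)|$. $a_n\sim b_n$ means $a_n/b_n\to1$. *)

theory Defs
  imports Complex_Main "HOL-Library.Landau_Symbols"
begin

text \<open>Regular expressions over the alphabet {0..<k} (letter i stands for sigma_(i+1));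
  the empty-set expression is not included.\<close>
datatype rexp = Eps | Sym nat | Plus rexp rexp | Times rexp rexp | Star rexp

fun rsize :: "rexp \<Rightarrow> nat" where
  "rsize Eps = 1"
| "rsize (Sym a) = 1"
| "rsize (Plus a b) = rsize a + rsize b + 1"
| "rsize (Times a b) = rsize a + rsize b + 1"
| "rsize (Star a) = rsize a + 1"

fun letters :: "rexp \<Rightarrow> nat list" where
  "letters Eps = []"
| "letters (Sym a) = [a]"
| "letters (Plus a b) = letters a @ letters b"
| "letters (Times a b) = letters a @ letters b"
| "letters (Star a) = letters a"

fun subexps :: "rexp \<Rightarrow> rexp set" where
  "subexps Eps = {Eps}"
| "subexps (Sym a) = {Sym a}"
| "subexps (Plus a b) = insert (Plus a b) (subexps a \<union> subexps b)"
| "subexps (Times a b) = insert (Times a b) (subexps a \<union> subexps b)"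
| "subexps (Star a) = insert (Star a) (subexps a)"

definition conc :: "'a list set \<Rightarrow> 'a list set \<Rightarrow> 'a list set" where
  "conc A B = {u @ v | u v. u \<in> A \<and> v \<in> B}"

inductive_set kstar :: "'a list set \<Rightarrow> 'a list set" for A where
  kstar_Nil: "[] \<in> kstar A"
| kstar_app: "u \<in> A \<Longrightarrow> v \<in> kstar A \<Longrightarrow> u @ v \<in> kstar A"

fun lang :: "rexp \<Rightarrow> nat list set" where
  "lang Eps = {[]}"
| "lang (Sym a) = {[a]}"
| "lang (Plus a b) = lang a \<union> lang b"
| "lang (Times a b) = conc (lang a) (lang b)"
| "lang (Star a) = kstar (lang a)"

fun mark :: "nat \<Rightarrow> rexp \<Rightarrow> rexp" where
  "mark i Eps = Eps"
| "mark i (Sym a) = Sym i"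
| "mark i (Plus a b) = Plus (mark i a) (mark (i + length (letters a)) b)"
| "mark i (Times a b) = Times (mark i a) (mark (i + length (letters a)) b)"
| "mark i (Star a) = Star (mark i a)"

definition marked :: "rexp \<Rightarrow> rexp" where
  "marked \<beta> = mark 1 \<beta>"

definition First :: "rexp \<Rightarrow> nat set" where
  "First \<beta> = {i. \<exists>w \<in> lang (marked \<beta>). w \<noteq> [] \<and> hd w = i}"

definition Last :: "rexp \<Rightarrow> nat set" where
  "Last \<beta> = {i. \<exists>w \<in> lang (marked \<beta>). w \<noteq> [] \<and> last w = i}"

definition Follow :: "rexp \<Rightarrow> (nat \<times> nat) set" where
  "Follow \<beta> = {(i, j). \<exists>w \<in> lang (marked \<beta>). \<exists>u v. w = u @ [i, j] @ v}"

definition glushkov_transitions :: "rexp \<Rightarrow> nat" where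
  "glushkov_transitions \<beta> = card (First \<beta>) + card (Follow \<beta>)"

fun union_tree :: "rexp \<Rightarrow> bool" where
  "union_tree (Sym a) = True"
| "union_tree (Plus a b) = (union_tree a \<and> union_tree b)"
| "union_tree _ = False"

definition sigma_star :: "nat \<Rightarrow> rexp \<Rightarrow> bool" where
  "sigma_star k \<beta> = (\<exists>\<tau>. \<beta> = Star \<tau> \<and> union_tree \<tau> \<and>
      distinct (letters \<tau>) \<and> set (letters \<tau>) = {..<k})"

definition RE_na :: "nat \<Rightarrow> rexp set" where
  "RE_na k = {\<beta>. set (letters \<beta>) \<subseteq> {..<k} \<and>
      (\<forall>b1 b2. Plus b1 b2 \<in> subexps \<beta> \<longrightarrow> \<not> sigma_star k b1 \<and> \<not> sigma_star k b2)}"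

definition r_count :: "nat \<Rightarrow> nat \<Rightarrow> nat" where
  "r_count k n = card {\<beta> \<in> RE_na k. rsize \<beta> = n}"

definition t_count :: "nat \<Rightarrow> nat \<Rightarrow> nat" where
  "t_count k n = (\<Sum>\<beta> \<in> {\<beta> \<in> RE_na k. rsize \<beta> = n}. glushkov_transitions \<beta>)"

end

theory Submission
  imports Defs "HOL-Complex_Analysis.Complex_Analysis" "HOL-Combinatorics.Multiset_Permutations"
    "HOL-Real_Asymp.Real_Asymp"
begin

text \<open>
  Let \<open>R\<close>, \<open>N\<close>, \<open>F\<close>, \<open>E\<close>, \<open>G\<close> be the generating functions of all expressions of the class, of the
  non-nullable ones, and of the total sizes of First, of Follow, and of Follow of the starred
  expression, and let \<open>S = c z\<^sup>2\<^sup>k\<close> be that of the \<open>\<Sigma>\<close>-star expressions. The unambiguous decomposition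
  of expressions makes \<open>R\<close> a root of a quadratic equation, so \<open>X = 1 - z - 4zR + 2zS\<close> is the square
  root of a polynomial \<open>\<Delta>\<close>. All other series solve linear equations over \<open>R\<close>, and elimination of \<open>G\<close> gives
  \<open>E X (X + z + 2zN) = A (X + 2zN) + z B\<close> with \<open>A\<close>, \<open>B\<close> built from \<open>R\<close>, \<open>S\<close>, \<open>F\<close>: thus \<open>E\<close> has an inverse
  square root singularity where \<open>R\<close> has a square root one, which is where the factor \<open>n\<close> comes from.

  With \<open>T = 1 - X\<close> having nonnegative coefficients and a nonzero
  linear one, the least positive root \<open>r\<close> of \<open>\<Delta> = (1 - T)\<^sup>2\<close> is its only root in the closed disc of
  radius \<open>r\<close>. Hence \<open>1/X\<close> is \<open>(1 - z/r)\<^sup>-\<^sup>1\<^sup>/\<^sup>2\<close> times a series with a larger radius of convergence.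
  The other factor of \<open>E\<close> lies in the algebra of series whose coefficients, scaled by \<open>r\<^sup>n\<close>, are absolutely
  summable and \<open>o(1/n)\<close>. This algebra contains \<open>1/(1 - G)\<close> for \<open>G \<ge> 0\<close> with \<open>G(r) < 1\<close>, and convolution with
  a sequence asymptotic to \<open>\<kappa> n\<^sup>-\<^sup>1\<^sup>/\<^sup>2\<close> merely multiplies \<open>\<kappa>\<close> by the value at \<open>r\<close>. The coefficients of
  \<open>X\<close> follow from \<open>X' = \<Delta>'/(2X)\<close>.
\<close>

unbundle no vec_syntax

section \<open>Convolution of sequences\<close>

text \<open>Tannery's theorem, that is dominated convergence for series: the terms with i > n are
  set to 0, and since \<open>d\<close> is bounded by some \<open>C\<close>, the i-th term is at most
  \<open>C\<close> times the modulus of \<open>a i\<close>, uniformly in n.\<close>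

lemma convolution_tendsto:
  fixes a d :: "nat \<Rightarrow> real"
  assumes a: "summable (\<lambda>n. \<bar>a n\<bar>)" and d: "d \<longlonglongrightarrow> L"
  shows "(\<lambda>n. \<Sum>i\<le>n. a i * d (n - i)) \<longlonglongrightarrow> (\<Sum>n. a n) * L"
proof -
  have "Bseq d" using d by (intro convergent_imp_Bseq convergentI)
  then obtain C where C: "C > 0" "\<And>n. \<bar>d n\<bar> \<le> C" by (auto elim!: BseqE)
  define f where "f = (\<lambda>i n. if i \<le> n then a i * d (n - i) else 0)"
  have "(\<lambda>n. \<Sum>i. f i n) \<longlonglongrightarrow> (\<Sum>i. a i * L)"
  proof (rule tannerys_theorem[THEN conjunct2, THEN conjunct2])
    fix i
    have "(\<lambda>n. d (n - i)) \<longlonglongrightarrow> L"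
      by (rule LIMSEQ_offset[of _ i]) (use d in simp)
    then have "(\<lambda>n. a i * d (n - i)) \<longlonglongrightarrow> a i * L"
      by (intro tendsto_intros)
    moreover have "\<forall>\<^sub>F n in sequentially. a i * d (n - i) = f i n"
      using eventually_ge_at_top[of i] by eventually_elim (simp add: f_def)
    ultimately show "(\<lambda>n. f i n) \<longlonglongrightarrow> a i * L"
      by (rule Lim_transform_eventually)
  next
    show "summable (\<lambda>i. \<bar>a i\<bar> * C)" using a by (rule summable_mult2)
    show "\<forall>\<^sub>F (k, n) in sequentially \<times>\<^sub>F sequentially. norm (f k n) \<le> \<bar>a k\<bar> * C"
      using C by (intro always_eventually) (auto simp: f_def abs_mult intro!: mult_left_mono)
  qed simp
  moreover have "(\<Sum>i. f i n) = (\<Sum>i\<le>n. a i * d (n - i))" for n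
    by (subst suminf_finite[of "{..n}"]) (auto simp: f_def)
  moreover have "(\<Sum>i. a i * L) = (\<Sum>n. a n) * L"
    by (rule suminf_mult2[symmetric]) (rule summable_rabs_cancel[OF a])
  ultimately show ?thesis by simp
qed

text \<open>Since v^2 = u^2 + 1, the induction step 2u + 1/v <= 2v amounts to (v - u)^2 >=
  0.\<close>

lemma sum_inverse_sqrt_le: "(\<Sum>i\<le>n. 1 / sqrt (real i + 1)) \<le> 2 * sqrt (real n + 1)"
proof (induction n)
  case (Suc n)
  define u where "u = sqrt (real n + 1)"
  define v where "v = sqrt (real n + 2)"
  have v: "v > 0" "u \<ge> 0" "v\<^sup>2 = real n + 2" "u\<^sup>2 = real n + 1" by (auto simp: u_def v_def)
  have "0 \<le> (v - u)\<^sup>2" by simp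
  then have "2 * u * v \<le> 2 * v * v - 1"
    using v by (simp add: power2_eq_square algebra_simps)
  then have "2 * u + 1 / v \<le> 2 * v"
    using v by (simp add: field_simps)
  then show ?case using Suc by (simp add: u_def v_def add.commute)
qed simp

text \<open>Controls the error term of \<open>convolution_inverse_sqrt\<close>. The first
  \<open>N\<close> terms contribute at most \<open>M * N\<close>, which is o(sqrt n); beyond
  \<open>N\<close> a small factor multiplies a sum of inverse square roots, which is O(sqrt
  n).\<close>

lemma null_convolution_inverse_sqrt:
  fixes d :: "nat \<Rightarrow> real"
  assumes d: "d \<longlonglongrightarrow> 0"
  shows "(\<lambda>n. (\<Sum>i\<le>n. \<bar>d i\<bar> / sqrt (real (n - i) + 1)) / sqrt n) \<longlonglongrightarrow> 0"
proof (rule LIMSEQ_I)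
  fix e :: real assume e: "e > 0"
  have "Bseq d" using d by (intro convergent_imp_Bseq convergentI)
  then obtain M where M: "M > 0" "\<And>n. \<bar>d n\<bar> \<le> M" by (auto elim!: BseqE)
  \<comment> \<open>The 8 leaves room for a factor 2 from \<open>sum_inverse_sqrt_le\<close> and a
    factor 2 from sqrt (n + 1) / sqrt n: these terms give e/2, the first \<open>N\<close> give
    e/4.\<close>
  obtain N where N: "\<And>i. i \<ge> N \<Longrightarrow> \<bar>d i\<bar> \<le> e / 8"
    using LIMSEQ_D[OF d, of "e/8"] e by (force simp: less_imp_le)
  have "(\<lambda>n. M * real N / sqrt (real n)) \<longlonglongrightarrow> 0" by real_asymp
  from LIMSEQ_D[OF this, of "e/4"] e obtain K where
    K: "\<And>n. n \<ge> K \<Longrightarrow> M * real N / sqrt (real n) < e / 4" using M by auto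
  show "\<exists>no. \<forall>n\<ge>no. norm ((\<Sum>i\<le>n. \<bar>d i\<bar> / sqrt (real (n - i) + 1)) / sqrt n - 0) < e"
  proof (intro exI[of _ "max K 1"] allI impI)
    fix n assume n: "n \<ge> max K 1"
    let ?w = "\<lambda>i. 1 / sqrt (real (n - i) + 1)"
    have w: "0 \<le> ?w i" "?w i \<le> 1" for i by auto
    have "(\<Sum>i\<le>n. \<bar>d i\<bar> * ?w i) \<le> (\<Sum>i\<le>n. (e/8) * ?w i + (if i < N then M else 0))"
    proof (rule sum_mono)
      fix i
      show "\<bar>d i\<bar> * ?w i \<le> (e/8) * ?w i + (if i < N then M else 0)"
      proof (cases "i < N")
        case True
        have "\<bar>d i\<bar> * ?w i \<le> M * 1" using M w by (intro mult_mono) (auto intro: less_imp_le)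
        moreover have "0 \<le> (e/8) * ?w i" using e w(1)[of i] by simp
        ultimately show ?thesis using True by simp
      next
        case False
        then have "\<bar>d i\<bar> * ?w i \<le> (e/8) * ?w i" using N[of i] w(1)[of i] by (intro mult_right_mono) auto
        then show ?thesis using False by simp
      qed
    qed
    also have "\<dots> = (e/8) * (\<Sum>i\<le>n. ?w i) + (\<Sum>i\<le>n. if i < N then M else 0)"
      by (simp add: sum.distrib sum_distrib_left)
    also have "(\<Sum>i\<le>n. ?w i) = (\<Sum>i\<le>n. 1 / sqrt (real i + 1))"
      by (rule sum.reindex_bij_witness[of _ "\<lambda>i. n - i" "\<lambda>i. n - i"]) auto
    also have "(\<Sum>i\<le>n. if i < N then M else 0) \<le> M * real N"
    proof -
      have "(\<Sum>i\<le>n. if i < N then M else 0) = (\<Sum>i\<in>{..n} \<inter> {i. i < N}. M)"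
        by (subst sum.inter_restrict) auto
      also have "\<dots> = real (card ({..n} \<inter> {i. i < N})) * M" by simp
      also have "\<dots> \<le> real N * M"
        using M(1) card_mono[of "{..<N}" "{..n} \<inter> {i. i < N}"]
        by (intro mult_right_mono) auto
      finally show ?thesis by (simp add: mult.commute)
    qed
    also have "(e/8) * (\<Sum>i\<le>n. 1 / sqrt (real i + 1)) \<le> (e/8) * (2 * sqrt (real n + 1))"
      using e sum_inverse_sqrt_le[of n] by (intro mult_left_mono) auto
    finally have "(\<Sum>i\<le>n. \<bar>d i\<bar> * ?w i) / sqrt n \<le> ((e/8) * (2 * sqrt (real n + 1)) + M * real N) / sqrt n"
      by (intro divide_right_mono) auto
    also have "\<dots> = (e/4) * (sqrt (real n + 1) / sqrt n) + M * real N / sqrt n"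
      by (simp add: add_divide_distrib)
    also have "sqrt (real n + 1) / sqrt n \<le> 2"
    proof -
      have "sqrt (real n + 1) \<le> sqrt (4 * real n)" using n by (intro real_sqrt_le_mono) auto
      then show ?thesis using n by (simp add: real_sqrt_mult divide_simps)
    qed
    also have "(e/4) * 2 + M * real N / sqrt n < e" using K[of n] n e by linarith
    finally have "(\<Sum>i\<le>n. \<bar>d i\<bar> * ?w i) / sqrt n < e" using e by simp
    moreover have "0 \<le> (\<Sum>i\<le>n. \<bar>d i\<bar> * ?w i) / sqrt n"
      by (intro divide_nonneg_nonneg sum_nonneg) auto
    ultimately show "norm ((\<Sum>i\<le>n. \<bar>d i\<bar> / sqrt (real (n - i) + 1)) / sqrt n - 0) < e" by simp
  qed
qed

text \<open>Splitting sqrt n = sqrt (n - i) + (sqrt n - sqrt (n - i)) leaves a convolution with a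
  convergent sequence and an error whose bracket is at most i / sqrt n. That i is absorbed into
  \<open>a i\<close>, which is why \<open>na\<close> is assumed.\<close>

lemma convolution_inverse_sqrt:
  fixes a p :: "nat \<Rightarrow> real"
  assumes a: "summable (\<lambda>n. \<bar>a n\<bar>)" and na: "(\<lambda>n. real n * a n) \<longlonglongrightarrow> 0"
    and p: "(\<lambda>n. p n * sqrt n) \<longlonglongrightarrow> \<kappa>"
  shows "(\<lambda>n. (\<Sum>i\<le>n. a i * p (n - i)) * sqrt n) \<longlonglongrightarrow> (\<Sum>n. a n) * \<kappa>"
proof -
  \<comment> \<open>Replacing sqrt n by sqrt (n + 1) gives a bound on \<open>p\<close> that also
    covers index 0, reached when i = n.\<close>
  have "(\<lambda>n. (p n * sqrt n) * (sqrt (real n + 1) / sqrt n)) \<longlonglongrightarrow> \<kappa> * 1"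
    by (intro tendsto_mult p) real_asymp
  moreover have "\<forall>\<^sub>F n in sequentially. (p n * sqrt n) * (sqrt (real n + 1) / sqrt n) = p n * sqrt (real n + 1)"
    using eventually_gt_at_top[of 0] by eventually_elim simp
  ultimately have "(\<lambda>n. p n * sqrt (real n + 1)) \<longlonglongrightarrow> \<kappa> * 1"
    by (rule Lim_transform_eventually)
  then have "Bseq (\<lambda>n. p n * sqrt (real n + 1))" by (intro convergent_imp_Bseq convergentI)
  then obtain C where C0: "C > 0" "\<And>n. \<bar>p n * sqrt (real n + 1)\<bar> \<le> C" by (auto elim!: BseqE)
  have C: "\<bar>p n\<bar> \<le> C / sqrt (real n + 1)" for n
    using C0(2)[of n] by (simp add: abs_mult field_simps)
  have split: "(\<Sum>i\<le>n. a i * p (n - i)) * sqrt n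
      = (\<Sum>i\<le>n. a i * (p (n - i) * sqrt (real (n - i)))) +
        (\<Sum>i\<le>n. a i * p (n - i) * (sqrt n - sqrt (real (n - i))))" for n
    unfolding sum.distrib[symmetric] sum_distrib_right by (intro sum.cong) (auto simp: algebra_simps)
  have lim1: "(\<lambda>n. \<Sum>i\<le>n. a i * (p (n - i) * sqrt (real (n - i)))) \<longlonglongrightarrow> (\<Sum>n. a n) * \<kappa>"
    by (rule convolution_tendsto[OF a p])
  have lim2: "(\<lambda>n. \<Sum>i\<le>n. a i * p (n - i) * (sqrt n - sqrt (real (n - i)))) \<longlonglongrightarrow> 0"
  proof (rule Lim_null_comparison)
    show "(\<lambda>n. C * ((\<Sum>i\<le>n. \<bar>real i * a i\<bar> / sqrt (real (n - i) + 1)) / sqrt n)) \<longlonglongrightarrow> 0"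
      using tendsto_mult_left[OF null_convolution_inverse_sqrt[OF na], of C] by simp
    show "\<forall>\<^sub>F n in sequentially. norm (\<Sum>i\<le>n. a i * p (n - i) * (sqrt n - sqrt (real (n - i))))
       \<le> C * ((\<Sum>i\<le>n. \<bar>real i * a i\<bar> / sqrt (real (n - i) + 1)) / sqrt n)"
      using eventually_gt_at_top[of 0]
    proof eventually_elim
      case (elim n)
      have "norm (\<Sum>i\<le>n. a i * p (n - i) * (sqrt n - sqrt (real (n - i))))
         \<le> (\<Sum>i\<le>n. C * ((\<bar>real i * a i\<bar> / sqrt (real (n - i) + 1)) / sqrt n))"
      proof (rule sum_norm_le)
        fix i assume i: "i \<in> {..n}"
        have "(sqrt n - sqrt (real (n - i))) * sqrt n \<le> real i"
        proof -
          have "real (n - i) = sqrt (real (n - i)) * sqrt (real (n - i))" by simp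
          also have "\<dots> \<le> sqrt (real (n - i)) * sqrt n"
            by (intro mult_left_mono) auto
          finally show ?thesis using i by (simp add: algebra_simps of_nat_diff)
        qed
        then have s: "sqrt n - sqrt (real (n - i)) \<le> real i / sqrt n"
          using elim by (simp add: field_simps)
        have "norm (a i * p (n - i) * (sqrt n - sqrt (real (n - i))))
            = \<bar>a i\<bar> * \<bar>p (n - i)\<bar> * (sqrt n - sqrt (real (n - i)))"
          by (simp add: abs_mult)
        also have "\<dots> \<le> \<bar>a i\<bar> * (C / sqrt (real (n - i) + 1)) * (real i / sqrt n)"
          using s C[of "n - i"] C0(1) by (intro mult_mono mult_left_mono) auto
        finally show "norm (a i * p (n - i) * (sqrt n - sqrt (real (n - i))))
          \<le> C * ((\<bar>real i * a i\<bar> / sqrt (real (n - i) + 1)) / sqrt n)"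
          by (simp add: abs_mult mult_ac)
      qed
      then show ?case by (simp add: sum_distrib_left sum_divide_distrib)
    qed
  qed
  show ?thesis using tendsto_add[OF lim1 lim2] unfolding split by simp
qed

section \<open>The algebra of tame series and evaluation at r\<close>

text \<open>Absolute summability alone would not be an ideal for the convolution with \<open>n\<^sup>-\<^sup>1\<^sup>/\<^sup>2\<close> below; the
  condition \<open>o(1/n)\<close> suffices for it and is inherited by products because \<open>z d/dz\<close> is a derivation.\<close>

definition tame :: "real \<Rightarrow> real fps \<Rightarrow> bool" where
  "tame r A \<longleftrightarrow> summable (\<lambda>n. \<bar>A $ n * r ^ n\<bar>) \<and> (\<lambda>n. real n * (A $ n * r ^ n)) \<longlonglongrightarrow> 0"

definition ev :: "real \<Rightarrow> real fps \<Rightarrow> real" where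
  "ev r A = (\<Sum>n. A $ n * r ^ n)"

lemma fps_mult_scaled:
  fixes A B :: "'a :: comm_ring_1 fps"
  shows "(A * B) $ n * r ^ n = (\<Sum>i\<le>n. (A $ i * r ^ i) * (B $ (n - i) * r ^ (n - i)))"
proof -
  have "(A * B) $ n * r ^ n = (\<Sum>i\<le>n. A $ i * B $ (n - i) * r ^ n)"
    by (simp add: fps_mult_nth sum_distrib_right atLeast0AtMost)
  also have "\<dots> = (\<Sum>i\<le>n. (A $ i * r ^ i) * (B $ (n - i) * r ^ (n - i)))"
  proof (rule sum.cong)
    fix i assume "i \<in> {..n}"
    then have "r ^ n = r ^ i * r ^ (n - i)" by (simp add: power_add[symmetric])
    then show "A $ i * B $ (n - i) * r ^ n = (A $ i * r ^ i) * (B $ (n - i) * r ^ (n - i))"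
      by (simp add: mult_ac)
  qed simp
  finally show ?thesis .
qed

lemma fps_convolution_inverse_sqrt:
  assumes "tame r A" and "(\<lambda>n. B $ n * r ^ n * sqrt n) \<longlonglongrightarrow> \<kappa>"
  shows "(\<lambda>n. (A * B) $ n * r ^ n * sqrt n) \<longlonglongrightarrow> ev r A * \<kappa>"
  unfolding fps_mult_scaled ev_def
  by (rule convolution_inverse_sqrt) (use assms in \<open>auto simp: tame_def\<close>)

lemma tameD:
  assumes "tame r A"
  shows "summable (\<lambda>n. \<bar>A $ n * r ^ n\<bar>)" "summable (\<lambda>n. A $ n * r ^ n)"
    "(\<lambda>n. real n * (A $ n * r ^ n)) \<longlonglongrightarrow> 0"
  using assms by (auto simp: tame_def intro: summable_rabs_cancel)

lemma abs_summable_mult: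
  fixes A B :: "real fps"
  assumes "summable (\<lambda>n. \<bar>A $ n * r ^ n\<bar>)" "summable (\<lambda>n. \<bar>B $ n * r ^ n\<bar>)"
  shows "summable (\<lambda>n. \<bar>(A * B) $ n * r ^ n\<bar>)"
proof (rule summable_comparison_test)
  show "summable (\<lambda>n. \<Sum>i\<le>n. \<bar>A $ i * r ^ i\<bar> * \<bar>B $ (n - i) * r ^ (n - i)\<bar>)"
    using assms by (intro summable_Cauchy_product) auto
  show "\<exists>N. \<forall>n\<ge>N. norm \<bar>(A * B) $ n * r ^ n\<bar> \<le> (\<Sum>i\<le>n. \<bar>A $ i * r ^ i\<bar> * \<bar>B $ (n - i) * r ^ (n - i)\<bar>)"
    unfolding fps_mult_scaled by (auto simp: abs_mult[symmetric] intro!: sum_abs)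
qed

lemma ev_mult_abs:
  assumes "summable (\<lambda>n. \<bar>A $ n * r ^ n\<bar>)" "summable (\<lambda>n. \<bar>B $ n * r ^ n\<bar>)"
  shows "ev r (A * B) = ev r A * ev r B"
  unfolding ev_def fps_mult_scaled
  by (rule Cauchy_product[symmetric]) (use assms in auto)

lemma tame_mult:
  assumes A: "tame r A" and B: "tame r B"
  shows "tame r (A * B)"
  unfolding tame_def
proof
  show "summable (\<lambda>n. \<bar>(A * B) $ n * r ^ n\<bar>)"
    by (intro abs_summable_mult tameD A B)
  let ?a = "\<lambda>n. A $ n * r ^ n" and ?b = "\<lambda>n. B $ n * r ^ n"
  \<comment> \<open>The Leibniz rule for z d/dz in coefficients: n = (n - i) + i, and each part is
    an absolutely summable sequence convolved with a null sequence.\<close>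
  have "real n * ((A * B) $ n * r ^ n) =
      (\<Sum>i\<le>n. ?b i * (real (n - i) * ?a (n - i))) + (\<Sum>i\<le>n. ?a i * (real (n - i) * ?b (n - i)))" for n
  proof -
    have "(\<Sum>i\<le>n. ?b i * (real (n - i) * ?a (n - i))) = (\<Sum>i\<le>n. ?b (n - i) * (real i * ?a i))"
      by (rule sum.reindex_bij_witness[of _ "\<lambda>i. n - i" "\<lambda>i. n - i"]) auto
    moreover have "(\<Sum>i\<le>n. ?b (n - i) * (real i * ?a i)) + (\<Sum>i\<le>n. ?a i * (real (n - i) * ?b (n - i)))
       = (\<Sum>i\<le>n. real n * (?a i * ?b (n - i)))"
      unfolding sum.distrib[symmetric] by (rule sum.cong) (auto simp: of_nat_diff algebra_simps)
    ultimately show ?thesis by (simp only: fps_mult_scaled sum_distrib_left)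
  qed
  moreover have "(\<lambda>n. (\<Sum>i\<le>n. ?b i * (real (n - i) * ?a (n - i))) + (\<Sum>i\<le>n. ?a i * (real (n - i) * ?b (n - i))))
     \<longlonglongrightarrow> (\<Sum>n. ?b n) * 0 + (\<Sum>n. ?a n) * 0"
    by (intro tendsto_add convolution_tendsto[where d = "\<lambda>n. real n * ?a n"]
          convolution_tendsto[where d = "\<lambda>n. real n * ?b n"] tameD A B)
  ultimately show "(\<lambda>n. real n * ((A * B) $ n * r ^ n)) \<longlonglongrightarrow> 0" by simp
qed

lemma tame_add: "tame r A \<Longrightarrow> tame r B \<Longrightarrow> tame r (A + B)"
  unfolding tame_def
proof (safe, goal_cases)
  case 1
  show ?case
  proof (rule summable_comparison_test[OF _ summable_add[OF 1(1) 1(3)]])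
    show "\<exists>N. \<forall>n\<ge>N. norm \<bar>(A + B) $ n * r ^ n\<bar> \<le> \<bar>A $ n * r ^ n\<bar> + \<bar>B $ n * r ^ n\<bar>"
      by (auto simp: distrib_right)
  qed
next
  case 2
  from tendsto_add[OF 2(2) 2(4)] show ?case by (simp add: algebra_simps)
qed

lemma tame_finite_support:
  assumes "\<And>n. n \<ge> m \<Longrightarrow> A $ n = 0"
  shows "tame r A"
proof -
  have "\<forall>\<^sub>F n in sequentially. 0 = real n * (A $ n * r ^ n)"
    using eventually_ge_at_top[of m] by eventually_elim (simp add: assms)
  then have "(\<lambda>n. real n * (A $ n * r ^ n)) \<longlonglongrightarrow> 0"
    by (rule Lim_transform_eventually[OF tendsto_const])
  moreover have "summable (\<lambda>n. \<bar>A $ n * r ^ n\<bar>)"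
    by (rule summable_finite[of "{..<m}"]) (auto simp: assms not_less)
  ultimately show ?thesis by (simp add: tame_def)
qed

lemma tame_fps_of_poly: "tame r (fps_of_poly p)"
  by (rule tame_finite_support[of "Suc (degree p)"]) (simp add: coeff_eq_0)

lemma ev_fps_of_poly: "ev r (fps_of_poly p) = poly p r"
  unfolding ev_def by (subst suminf_finite[of "{..degree p}"]) (auto simp: coeff_eq_0 poly_altdef)

lemma tame_const [simp]: "tame r (fps_const c)"
  using tame_fps_of_poly[of r "[:c:]"] by (simp add: fps_of_poly_const)
lemma tame_X [simp]: "tame r fps_X"
  using tame_fps_of_poly[of r "[:0,1:]"] by simp
lemma tame_1 [simp]: "tame r 1"
  using tame_const[of r 1] by simp
lemma tame_numeral [simp]: "tame r (numeral n)"
  using tame_fps_of_poly[of r "numeral n"] by simp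
lemma tame_uminus: "tame r A \<Longrightarrow> tame r (- A)"
  using tame_mult[OF tame_const[of r "-1"], of A] by (simp flip: fps_const_neg)
lemma tame_diff: "tame r A \<Longrightarrow> tame r B \<Longrightarrow> tame r (A - B)"
  using tame_add[of r A "-B"] tame_uminus[of r B] by simp
lemma tame_power: "tame r A \<Longrightarrow> tame r (A ^ n)"
  by (induction n) (auto intro: tame_mult)

lemmas tame_intros = tame_mult tame_add tame_diff tame_uminus tame_power
  tame_const tame_X tame_1 tame_numeral

lemma ev_const [simp]: "ev r (fps_const c) = c"
  using ev_fps_of_poly[of r "[:c:]"] by (simp add: fps_of_poly_const)
lemma ev_X [simp]: "ev r fps_X = r"
  using ev_fps_of_poly[of r "[:0,1:]"] by simp
lemma ev_1 [simp]: "ev r 1 = 1"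
  using ev_const[of r 1] by simp
lemma ev_numeral [simp]: "ev r (numeral n) = numeral n"
  using ev_fps_of_poly[of r "numeral n"] by simp
lemma ev_mult: "tame r A \<Longrightarrow> tame r B \<Longrightarrow> ev r (A * B) = ev r A * ev r B"
  by (intro ev_mult_abs tameD)
lemma ev_add: "tame r A \<Longrightarrow> tame r B \<Longrightarrow> ev r (A + B) = ev r A + ev r B"
  unfolding ev_def by (simp add: distrib_right suminf_add[symmetric] tameD)
lemma ev_uminus: "tame r A \<Longrightarrow> ev r (- A) = - ev r A"
  unfolding ev_def by (simp add: suminf_minus tameD)
lemma ev_diff: "tame r A \<Longrightarrow> tame r B \<Longrightarrow> ev r (A - B) = ev r A - ev r B"
  using ev_add[of r A "-B"] by (simp add: tame_uminus ev_uminus)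
lemma ev_power: "tame r A \<Longrightarrow> ev r (A ^ n) = ev r A ^ n"
  by (induction n) (auto simp: ev_mult tame_power)

lemmas ev_simps = ev_mult ev_add ev_diff ev_uminus ev_power

text \<open>The index pairs with i + l <= n form a triangle inside a square, and all terms are
  nonnegative.\<close>

lemma partial_sum_mult_le:
  fixes A B :: "real fps"
  assumes "\<And>n. A $ n \<ge> 0" "\<And>n. B $ n \<ge> 0" "x \<ge> 0"
  shows "(\<Sum>m\<le>n. (A * B) $ m * x ^ m) \<le> (\<Sum>m\<le>n. A $ m * x ^ m) * (\<Sum>m\<le>n. B $ m * x ^ m)"
proof -
  let ?a = "\<lambda>n. A $ n * x ^ n" and ?b = "\<lambda>n. B $ n * x ^ n"
  have ab: "0 \<le> ?a i * ?b l" for i l using assms by simp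
  have "(\<Sum>m\<le>n. (A * B) $ m * x ^ m) = (\<Sum>(i, l)\<in>{(i, l). i + l \<le> n}. ?a i * ?b l)"
    unfolding fps_mult_scaled by (rule sum.triangle_reindex_eq[symmetric])
  also have "\<dots> \<le> (\<Sum>(i, l)\<in>{..n} \<times> {..n}. ?a i * ?b l)"
    by (intro sum_mono2) (use ab in auto)
  also have "\<dots> = (\<Sum>i\<le>n. ?a i) * (\<Sum>l\<le>n. ?b l)"
    by (simp add: sum_product sum.cartesian_product)
  finally show ?thesis .
qed

text \<open>From J = 1 + G J the coefficients of J are nonnegative by recursion, and every partial
  sum of J at r is at most 1 plus G(r) times itself, hence at most 1 / (1 - G(r)).\<close>

lemma tame_inverse_one_minus:
  assumes G: "tame r G" and nonneg: "\<And>n. G $ n \<ge> 0" and G0: "G $ 0 = 0"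
    and r: "r > 0" and ev: "ev r G < 1"
  shows "tame r (inverse (1 - G))"
proof -
  define J where "J = inverse (1 - G)"
  have J1: "J * (1 - G) = 1"
    unfolding J_def by (rule inverse_mult_eq_1) (simp add: G0)
  then have J: "J = 1 + G * J" by (simp add: algebra_simps)
  have Jpos: "J $ n \<ge> 0" for n
  proof (induction n rule: less_induct)
    case (less n)
    have "(\<Sum>i=0..n. G $ i * J $ (n - i)) \<ge> 0"
    proof (rule sum_nonneg)
      fix i assume "i \<in> {0..n}"
      then show "G $ i * J $ (n - i) \<ge> 0"
        by (cases "i = 0") (auto simp: G0 intro!: mult_nonneg_nonneg nonneg less)
    qed
    then have "0 \<le> (1 + G * J) $ n" by (simp add: fps_mult_nth)
    then show ?case using J by simp
  qed
  let ?g = "\<lambda>n. G $ n * r ^ n" and ?j = "\<lambda>n. J $ n * r ^ n"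
  have g: "?g n \<ge> 0" and j: "?j n \<ge> 0" for n using nonneg Jpos r by auto
  have "summable ?j"
  proof (rule bounded_imp_summable)
    fix n
    have "(\<Sum>m\<le>n. ?j m) = (\<Sum>m\<le>n. (if m = 0 then 1 else 0) + (\<Sum>i\<le>m. ?g i * ?j (m - i)))"
    proof (rule sum.cong)
      fix m
      have "?j m = (1 + G * J) $ m * r ^ m" using J by simp
      then show "?j m = (if m = 0 then 1 else 0) + (\<Sum>i\<le>m. ?g i * ?j (m - i))"
        unfolding fps_mult_scaled[symmetric] by (simp add: distrib_right)
    qed simp
    also have "\<dots> = 1 + (\<Sum>m\<le>n. \<Sum>i\<le>m. ?g i * ?j (m - i))"
      by (simp add: sum.distrib)
    also have "(\<Sum>m\<le>n. \<Sum>i\<le>m. ?g i * ?j (m - i)) \<le> (\<Sum>i\<le>n. ?g i) * (\<Sum>l\<le>n. ?j l)"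
      using partial_sum_mult_le[of G J r n] nonneg Jpos r unfolding fps_mult_scaled by simp
    also have "\<dots> \<le> ev r G * (\<Sum>l\<le>n. ?j l)"
      unfolding ev_def using g j
      by (intro mult_right_mono sum_le_suminf tameD G sum_nonneg) auto
    finally have "(\<Sum>m\<le>n. ?j m) * (1 - ev r G) \<le> 1" by (simp add: algebra_simps)
    then show "(\<Sum>m\<le>n. ?j m) \<le> 1 / (1 - ev r G)" using ev by (simp add: field_simps)
  qed (use j in auto)
  then have sj: "summable (\<lambda>n. \<bar>J $ n * r ^ n\<bar>)" using j by simp
  \<comment> \<open>The derivation \<open>D = z d/dz\<close> gives \<open>D (1/(1-G)) = D G / (1-G)\<^sup>2\<close>, a null sequence convolved with a summable one.\<close>
  define D :: "real fps \<Rightarrow> real fps" where "D = (\<lambda>A. fps_X * fps_deriv A)"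
  have D: "D A $ n = real n * A $ n" for A n by (cases n) (auto simp: D_def)
  have "D (J * (1 - G)) = D J * (1 - G) - J * D G" by (simp add: D_def algebra_simps)
  moreover have "D (J * (1 - G)) = 0" unfolding J1 by (simp add: D_def)
  ultimately have "D J * (1 - G) = J * D G" by simp
  then have "(D J * (1 - G)) * J = (J * D G) * J" by simp
  then have "D J * (J * (1 - G)) = (J * J) * D G" by (simp only: mult_ac)
  then have DJ: "D J = (J * J) * D G" using J1 by simp
  have "(\<lambda>n. \<Sum>i\<le>n. ((J * J) $ i * r ^ i) * (D G $ (n - i) * r ^ (n - i))) \<longlonglongrightarrow> (\<Sum>n. (J * J) $ n * r ^ n) * 0"
    by (rule convolution_tendsto[OF abs_summable_mult[OF sj sj], where d = "\<lambda>n. D G $ n * r ^ n"])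
       (use tameD(3)[OF G] in \<open>simp add: D mult_ac\<close>)
  then have "(\<lambda>n. D J $ n * r ^ n) \<longlonglongrightarrow> 0"
    unfolding fps_mult_scaled[symmetric] DJ by simp
  then show ?thesis using sj by (simp add: tame_def J_def D mult_ac)
qed

section \<open>Square root singularities\<close>

text \<open>The derivative has at least the same radius of convergence, so its terms at r are
  summable and in particular null. Only moduli of coefficients enter, so a complex expansion known
  up to sign suffices.\<close>

lemma tame_if_conv_radius:
  fixes V :: "real fps"
  assumes r: "r > 0" and R: "fps_conv_radius F > ereal r"
    and F: "\<And>n. norm (F $ n :: complex) = \<bar>V $ n\<bar>"
  shows "tame r V"
  unfolding tame_def
proof
  have n: "norm (complex_of_real r) = r" using r by simp
  have "summable (\<lambda>n. norm (F $ n * complex_of_real r ^ n))"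
    by (rule norm_summable_fps) (use R n in simp)
  then show "summable (\<lambda>n. \<bar>V $ n * r ^ n\<bar>)"
    using r by (simp add: norm_mult norm_power F abs_mult)
  have "summable (\<lambda>n. norm (fps_deriv F $ n * complex_of_real r ^ n))"
    by (rule norm_summable_fps) (use R n fps_conv_radius_deriv[of F] in \<open>auto intro: less_le_trans\<close>)
  then have "summable (\<lambda>n. real (Suc n) * \<bar>V $ Suc n\<bar> * r ^ n)"
    using r by (simp add: norm_mult norm_power F flip: of_nat_Suc del: of_nat_Suc)
  from tendsto_mult_left[OF summable_LIMSEQ_zero[OF this], of r]
  have "(\<lambda>n. real (Suc n) * \<bar>V $ Suc n\<bar> * r ^ Suc n) \<longlonglongrightarrow> 0" by (simp add: mult_ac)
  then have "(\<lambda>n. real n * \<bar>V $ n\<bar> * r ^ n) \<longlonglongrightarrow> 0"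
    by (rule LIMSEQ_offset[where k = 1, unfolded Suc_eq_plus1[symmetric]])
  then show "(\<lambda>n. real n * (V $ n * r ^ n)) \<longlonglongrightarrow> 0"
    by (rule Lim_null_comparison[rotated]) (use r in \<open>auto simp: abs_mult\<close>)
qed

lemma poly_map_poly_of_real:
  "poly (map_poly complex_of_real p) z = (\<Sum>n\<le>degree p. of_real (coeff p n) * z ^ n)"
  by (simp add: poly_altdef coeff_map_poly degree_map_poly)

text \<open>Having finitely many roots, Q is zero-free on an open disc of radius R > r. The disc is
  contractible, so Q has a holomorphic square root there, and the expansion of its reciprocal has
  radius of convergence at least R.\<close>

lemma tame_inverse_sqrt_poly:
  fixes V :: "real fps"
  assumes r: "r > 0" and V: "V * V * fps_of_poly Q = 1"
    and nz: "\<And>z. norm z \<le> r \<Longrightarrow> poly (map_poly complex_of_real Q) z \<noteq> 0"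
  shows "tame r V"
proof -
  define Qc where "Qc = map_poly complex_of_real Q"
  define cf :: "real fps \<Rightarrow> complex fps" where "cf = (\<lambda>f. Abs_fps (\<lambda>n. of_real (f $ n)))"
  have cf_mult: "cf (f * g) = cf f * cf g" for f g
    by (simp add: cf_def fps_eq_iff fps_mult_nth)
  have "cf 1 = 1" by (simp add: cf_def fps_eq_iff)
  moreover have "cf (fps_of_poly Q) = fps_of_poly Qc"
    by (simp add: cf_def Qc_def fps_eq_iff coeff_map_poly)
  ultimately have Vc: "cf V * cf V * fps_of_poly Qc = 1"
    using arg_cong[OF V, of cf] by (simp add: cf_mult)
  have "Qc \<noteq> 0" using nz[of 0] r unfolding Qc_def by auto
  then have fin: "finite {z. poly Qc z = 0}" by (rule poly_roots_finite)
  obtain R where R: "R > r" "\<And>z. z \<in> ball 0 R \<Longrightarrow> poly Qc z \<noteq> 0"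
  proof (cases "{z. poly Qc z = 0} = {}")
    case True
    then show ?thesis using that[of "r + 1"] by auto
  next
    case False
    let ?R = "Min (norm ` {z. poly Qc z = 0})"
    have "?R > r"
      using fin False nz by (subst Min_gr_iff) (auto simp: Qc_def[symmetric] not_le[symmetric])
    moreover have "poly Qc z \<noteq> 0" if "z \<in> ball 0 ?R" for z
    proof
      assume "poly Qc z = 0"
      then have "?R \<le> norm z" using fin by (intro Min_le) auto
      then show False using that by simp
    qed
    ultimately show ?thesis using that by blast
  qed
  obtain g where g: "g holomorphic_on ball 0 R" "\<And>z. z \<in> ball 0 R \<Longrightarrow> poly Qc z = g z ^ 2"
    by (rule contractible_imp_holomorphic_sqrt[of "poly Qc" "ball 0 R"])
       (use R in \<open>auto intro: holomorphic_intros convex_imp_contractible\<close>)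
  define h where "h = (\<lambda>z. inverse (g z))"
  have gnz: "g z \<noteq> 0" if "z \<in> ball 0 R" for z using R(2)[OF that] g(2)[OF that] by auto
  have h: "h holomorphic_on ball 0 R" unfolding h_def
    by (intro holomorphic_intros g gnz)
  define F where "F = fps_expansion h 0"
  have F: "h has_fps_expansion F"
    unfolding F_def using R r by (intro has_fps_expansion_fps_expansion[OF _ _ h]) auto
  have radF: "fps_conv_radius F \<ge> R"
    by (rule holomorphic_on_imp_fps_conv_radius_ge[OF F]) (use h in simp)
  have "poly Qc has_fps_expansion fps_of_poly Qc"
    using eval_fps_has_fps_expansion[of "fps_of_poly Qc"] by (simp add: eval_fps_of_poly[abs_def])
  then have "(\<lambda>z. h z * h z * poly Qc z) has_fps_expansion F * F * fps_of_poly Qc"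
    by (intro has_fps_expansion_mult F)
  moreover have "(\<lambda>z. h z * h z * poly Qc z) has_fps_expansion 1"
  proof -
    have "\<forall>\<^sub>F z in nhds 0. z \<in> ball 0 R"
      using R r by (intro eventually_nhds_in_open) auto
    then have "\<forall>\<^sub>F z in nhds 0. h z * h z * poly Qc z = 1"
      by eventually_elim (use gnz g in \<open>auto simp: h_def power2_eq_square field_simps\<close>)
    then show ?thesis
      by (subst has_fps_expansion_cong[of _ "\<lambda>_. 1"]) auto
  qed
  ultimately have "F * F * fps_of_poly Qc = 1" by (rule fps_expansion_unique_complex)
  \<comment> \<open>Formal power series form an integral domain, so equal squares identify the
    analytic expansion with V up to sign.\<close>
  with Vc have "(F * F) * fps_of_poly Qc = (cf V * cf V) * fps_of_poly Qc" by simp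
  moreover have "fps_of_poly Qc \<noteq> 0" using \<open>Qc \<noteq> 0\<close> by simp
  ultimately have "F * F = cf V * cf V" by (simp only: mult_cancel_right) simp
  then have "F = cf V \<or> F = - cf V" by (simp only: square_eq_iff)
  then have "norm (F $ n) = \<bar>V $ n\<bar>" for n by (auto simp: cf_def)
  moreover have "ereal r < fps_conv_radius F"
    by (rule less_le_trans[OF _ radF]) (use R(1) in simp)
  ultimately show ?thesis using r by (intro tame_if_conv_radius)
qed

text \<open>P is (1 - z/r)^(-1/2), the binomial series composed with -z/r; the limit is 1 /
  Gamma(1/2).\<close>

lemma inverse_sqrt_linear_fps:
  fixes r :: real
  assumes r: "r > 0"
  obtains P \<kappa> where "P * P * (1 - fps_const (1 / r) * fps_X) = 1" "P $ 0 = 1"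
    "(\<lambda>n. P $ n * r ^ n * sqrt n) \<longlonglongrightarrow> \<kappa>" "\<kappa> \<noteq> 0"
proof -
  define B :: "real fps" where "B = fps_binomial (-1/2)"
  define L :: "real fps" where "L = fps_const (- 1 / r) * fps_X"
  define P where "P = B oo L"
  have L0: "L $ 0 = 0" by (simp add: L_def)
  have "B * B = fps_binomial (-1)" by (simp add: B_def fps_binomial_add_mult[symmetric])
  then have "B * B * (1 + fps_X) = 1"
    by (simp add: fps_binomial_minus_one inverse_mult_eq_1)
  then have "(B * B * (1 + fps_X)) oo L = 1" by simp
  then have 1: "P * P * (1 - fps_const (1 / r) * fps_X) = 1"
    by (simp add: fps_compose_mult_distrib[OF L0] fps_compose_add_distrib P_def fps_X_fps_compose_startby0[OF L0])
       (simp add: L_def flip: fps_const_neg)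
  have Pn: "P $ n * r ^ n = (-1) ^ n * ((-1/2) gchoose n)" for n
  proof -
    have "P $ n = (- 1 / r) ^ n * ((-1/2) gchoose n)"
      unfolding P_def L_def B_def by (simp only: fps_nth_compose_linear fps_binomial_nth)
    moreover have "(- 1 / r) ^ n * r ^ n = (-1) ^ n"
      using r by (simp flip: power_mult_distrib)
    ultimately show ?thesis by (simp add: mult_ac)
  qed
  have "(\<lambda>n. ((-1/2 :: real) gchoose n) / ((-1) ^ n / exp ((-1/2 + 1) * of_real (ln (real n))))) \<longlonglongrightarrow> inverse (Gamma (- (-1/2)))"
    by (rule gbinomial_asymptotic)
  moreover have "\<forall>\<^sub>F n in sequentially. ((-1/2 :: real) gchoose n) / ((-1) ^ n / exp ((-1/2 + 1) * of_real (ln (real n)))) = P $ n * r ^ n * sqrt n"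
    using eventually_gt_at_top[of 0]
  proof eventually_elim
    case (elim n)
    have "exp ((-1/2 + 1) * of_real (ln (real n))) = sqrt (real n)"
    proof -
      have "exp ((-1/2 + 1) * of_real (ln (real n))) = exp (ln (sqrt (real n)))"
        using elim by (simp add: ln_sqrt)
      then show ?thesis using elim by simp
    qed
    moreover have "(-1 :: real) ^ n = 1 \<or> (-1 :: real) ^ n = -1" by (cases "even n") auto
    ultimately show ?case by (auto simp: Pn)
  qed
  ultimately have "(\<lambda>n. P $ n * r ^ n * sqrt n) \<longlonglongrightarrow> inverse (Gamma (- (-1/2)))"
    by (rule Lim_transform_eventually)
  moreover have "inverse (Gamma (- (-1/2) :: real)) \<noteq> 0"
    by (simp add: Gamma_one_half_real)
  moreover have "P $ 0 = 1" using Pn[of 0] by simp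
  ultimately show ?thesis using that 1 by blast
qed

lemma map_poly_complex_of_real_mult:
  "map_poly complex_of_real (p * q) = map_poly complex_of_real p * map_poly complex_of_real q"
  by (simp add: poly_eq_iff coeff_map_poly coeff_mult)

section \<open>Series T with nonnegative coefficients for which (1 - T)^2 is a polynomial\<close>

context
  fixes T :: "real fps" and \<Delta> :: "real poly" and r :: real
  assumes r: "r > 0" and T_nonneg: "\<And>n. T $ n \<ge> 0" and T0: "T $ 0 = 0" and T1: "T $ 1 > 0"
    and square: "(1 - T) * (1 - T) = fps_of_poly \<Delta>"
    and pos: "\<And>x. 0 \<le> x \<Longrightarrow> x < r \<Longrightarrow> poly \<Delta> x > 0"
    and root: "poly \<Delta> r = 0" and simple_root: "poly (pderiv \<Delta>) r \<noteq> 0"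
begin

text \<open>Truncating \<open>(1 - T)\<^sup>2 = \<Delta>\<close> beyond the degree of \<open>\<Delta>\<close> gives \<open>(1 - T\<^sub>M(x))\<^sup>2 \<ge> \<Delta>(x) > 0\<close>, so the partial
  sum \<open>T\<^sub>M\<close>, being \<open>0\<close> at \<open>0\<close>, cannot cross \<open>1\<close> before \<open>r\<close>.\<close>

lemma partial_sum_le_1: "(\<Sum>n\<le>M. T $ n * r ^ n) \<le> 1"
proof (rule ccontr)
  assume "\<not> ?thesis"
  \<comment> \<open>The truncation is moved up to the degree of \<open>\<Delta>\<close> at least, so
    that all coefficients of \<open>\<Delta>\<close> are covered.\<close>
  moreover have "(\<Sum>n\<le>M. T $ n * r ^ n) \<le> (\<Sum>n\<le>max M (degree \<Delta>). T $ n * r ^ n)"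
    using r T_nonneg by (intro sum_mono2) auto
  ultimately have gt: "(\<Sum>n\<le>max M (degree \<Delta>). T $ n * r ^ n) > 1" by simp
  define N where "N = max M (degree \<Delta>)"
  define \<tau> where "\<tau> = (\<lambda>x. \<Sum>n\<le>N. T $ n * x ^ n)"
  have "\<tau> 0 = 0" unfolding \<tau>_def by (rule sum.neutral) (auto simp: T0 power_0_left)
  moreover have "continuous_on {0..r} \<tau>" unfolding \<tau>_def by (intro continuous_intros)
  ultimately obtain y where y: "0 \<le> y" "y \<le> r" "\<tau> y = 1"
    using IVT'[of \<tau> 0 1 r] gt r by (auto simp: \<tau>_def N_def)
  have "y \<noteq> r" using gt y by (auto simp: \<tau>_def N_def)
  then have "poly \<Delta> y > 0" using y by (intro pos) auto
  moreover have "poly \<Delta> y \<le> (1 - \<tau> y)\<^sup>2"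
  proof -
    have "poly \<Delta> y = (\<Sum>n\<le>N. coeff \<Delta> n * y ^ n)"
      unfolding poly_altdef by (rule sum.mono_neutral_left) (auto simp: N_def coeff_eq_0)
    also have "\<dots> = (\<Sum>n\<le>N. ((1 - T) * (1 - T)) $ n * y ^ n)" by (simp add: square)
    also have "(1 - T) * (1 - T) = 1 - (T + T) + T * T" by (simp add: algebra_simps)
    also have "(\<Sum>n\<le>N. (1 - (T + T) + T * T) $ n * y ^ n)
       = (\<Sum>n\<le>N. (if n = 0 then 1 else 0) - (T $ n * y ^ n + T $ n * y ^ n) + (T * T) $ n * y ^ n)"
      by (intro sum.cong) (simp_all add: left_diff_distrib distrib_right)
    also have "\<dots> = 1 - (\<tau> y + \<tau> y) + (\<Sum>n\<le>N. (T * T) $ n * y ^ n)"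
      by (simp add: sum.distrib sum_subtractf \<tau>_def sum_distrib_left)
    also have "(\<Sum>n\<le>N. (T * T) $ n * y ^ n) \<le> \<tau> y * \<tau> y"
      unfolding \<tau>_def using T_nonneg y by (intro partial_sum_mult_le) auto
    finally show ?thesis by (simp add: power2_eq_square algebra_simps)
  qed
  ultimately show False using y by simp
qed

lemma abs_summable_T: "summable (\<lambda>n. \<bar>T $ n * r ^ n\<bar>)"
proof -
  have "summable (\<lambda>n. T $ n * r ^ n)"
    using partial_sum_le_1 T_nonneg r by (intro bounded_imp_summable) auto
  then show ?thesis using T_nonneg r by simp
qed

lemma abs_summable_one_minus_T: "summable (\<lambda>n. \<bar>(1 - T) $ n * r ^ n\<bar>)"
proof (rule summable_comparison_test)
  show "summable (\<lambda>n. (if n = 0 then 1 else 0) + \<bar>T $ n * r ^ n\<bar>)"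
    by (intro summable_add abs_summable_T) (rule summable_finite[of "{0}"], auto)
  show "\<exists>N. \<forall>n\<ge>N. norm \<bar>(1 - T) $ n * r ^ n\<bar> \<le> (if n = 0 then 1 else 0) + \<bar>T $ n * r ^ n\<bar>"
    by (auto simp: T0)
qed

text \<open>Evaluation is multiplicative on absolutely summable series, so (1 - T(r))^2 =
  \<open>\<Delta>\<close>(r) = 0. That T is tame follows only later, in
  \<open>sqrt_singularity\<close>.\<close>

lemma suminf_T: "(\<Sum>n. T $ n * r ^ n) = 1"
proof -
  have "ev r (1 - T) * ev r (1 - T) = poly \<Delta> r"
    using ev_mult_abs[OF abs_summable_one_minus_T abs_summable_one_minus_T]
    by (simp add: square ev_fps_of_poly)
  then have "ev r (1 - T) = 0" using root by simp
  moreover have "ev r (1 - T) = (\<Sum>n. (if n = 0 then 1 else 0) - T $ n * r ^ n)"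
    unfolding ev_def by (intro suminf_cong) (auto simp: T0)
  moreover have "\<dots> = (\<Sum>n. if n = 0 then 1 else 0) - (\<Sum>n. T $ n * r ^ n)"
    by (intro suminf_diff[symmetric] summable_rabs_cancel[OF abs_summable_T])
       (rule summable_finite[of "{0}"], auto)
  moreover have "(\<Sum>n::nat. if n = 0 then 1 else 0 :: real) = 1"
    by (subst suminf_finite[of "{0}"]) auto
  ultimately show ?thesis by simp
qed

text \<open>A root z would give T(z) = 1 = T(r). Termwise the real part of T_n z^n is at most T_n
  r^n, so equality holds in every term; the linear one, with T_1 > 0, forces Re z = r and hence z =
  r.\<close>

lemma poly_nonzero_disc:
  assumes z: "norm z \<le> r" "z \<noteq> of_real r"
  shows "poly (map_poly complex_of_real \<Delta>) z \<noteq> 0"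
proof
  assume root0: "poly (map_poly complex_of_real \<Delta>) z = 0"
  define t where "t = (\<lambda>n. of_real (T $ n) * z ^ n)"
  define u where "u = (\<lambda>n. of_real ((1 - T) $ n) * z ^ n)"
  have tb: "norm (t n) \<le> T $ n * r ^ n" for n
    using T_nonneg[of n] z by (auto simp: t_def norm_mult norm_power intro!: mult_left_mono power_mono)
  have st: "summable (\<lambda>n. norm (t n))"
    by (rule summable_comparison_test[OF _ abs_summable_T]) (use order_trans[OF tb abs_ge_self] in auto)
  have ub: "norm (u n) \<le> \<bar>(1 - T) $ n * r ^ n\<bar>" for n
  proof -
    have "norm (u n) = \<bar>(1 - T) $ n\<bar> * norm z ^ n"
      unfolding u_def norm_mult norm_power norm_of_real by simp
    also have "\<dots> \<le> \<bar>(1 - T) $ n\<bar> * r ^ n"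
      using z by (intro mult_left_mono power_mono) auto
    finally show ?thesis using r by (simp only: abs_mult power_abs abs_of_pos)
  qed
  have su: "summable (\<lambda>n. norm (u n))"
    by (rule summable_comparison_test[OF _ abs_summable_one_minus_T]) (use ub in auto)
  have "(\<Sum>i\<le>n. u i * u (n - i)) = of_real (coeff \<Delta> n) * z ^ n" for n
  proof -
    have "(\<Sum>i\<le>n. u i * u (n - i)) = of_real (\<Sum>i\<le>n. (1 - T) $ i * (1 - T) $ (n - i)) * z ^ n"
      unfolding of_real_sum sum_distrib_right
    proof (rule sum.cong)
      fix i assume "i \<in> {..n}"
      then have "z ^ n = z ^ i * z ^ (n - i)" by (simp add: power_add[symmetric])
      then show "u i * u (n - i) = of_real ((1 - T) $ i * (1 - T) $ (n - i)) * z ^ n"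
        by (simp add: u_def mult_ac)
    qed simp
    also have "(\<Sum>i\<le>n. (1 - T) $ i * (1 - T) $ (n - i)) = ((1 - T) * (1 - T)) $ n"
      by (simp add: fps_mult_nth atLeast0AtMost)
    finally show ?thesis by (simp add: square)
  qed
  then have "(\<Sum>n. u n) * (\<Sum>n. u n) = (\<Sum>n. of_real (coeff \<Delta> n) * z ^ n)"
    using Cauchy_product[OF su su] by simp
  also have "\<dots> = poly (map_poly complex_of_real \<Delta>) z"
    unfolding poly_map_poly_of_real
    by (rule suminf_finite) (auto simp: coeff_eq_0)
  finally have "(\<Sum>n. u n) = 0" using root0 by simp
  moreover have "(\<Sum>n. u n) = 1 - (\<Sum>n. t n)"
  proof -
    have "(\<Sum>n. u n) = (\<Sum>n. (if n = 0 then 1 else 0) - t n)"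
      by (intro suminf_cong) (auto simp: u_def t_def T0)
    also have "\<dots> = (\<Sum>n. if n = 0 then 1 else 0) - (\<Sum>n. t n)"
      by (intro suminf_diff[symmetric] summable_norm_cancel[OF st])
         (rule summable_finite[of "{0}"], auto)
    also have "(\<Sum>n::nat. if n = 0 then 1 else 0 :: complex) = 1"
      by (subst suminf_finite[of "{0}"]) auto
    finally show ?thesis .
  qed
  ultimately have "(\<Sum>n. t n) = 1" by simp
  then have Re1: "(\<Sum>n. Re (t n)) = 1"
    using Re_suminf[OF summable_norm_cancel[OF st]] by simp
  have sRe: "summable (\<lambda>n. Re (t n))"
    using summable_norm_cancel[OF st] by (rule summable_Re)
  have sT: "summable (\<lambda>n. T $ n * r ^ n)" by (rule summable_rabs_cancel[OF abs_summable_T])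
  have "(\<Sum>n. T $ n * r ^ n - Re (t n)) = 0"
    using suminf_diff[OF sT sRe] Re1 suminf_T by simp
  then have "\<forall>n. T $ n * r ^ n - Re (t n) = 0"
  proof (subst (asm) suminf_eq_zero_iff)
    show "0 \<le> T $ n * r ^ n - Re (t n)" for n
      using tb[of n] complex_Re_le_cmod[of "t n"] by simp
  qed (use sT sRe in \<open>auto intro: summable_diff\<close>)
  from this[rule_format, of 1] have "Re z = r" using T1 by (simp add: t_def)
  moreover have "(cmod z)\<^sup>2 \<le> r\<^sup>2" using z(1) by (intro power_mono) auto
  ultimately have "Im z = 0" by (simp add: cmod_power2)
  then show False using z(2) \<open>Re z = r\<close> by (simp add: complex_eq_iff)
qed

text \<open>Splitting off the simple root, \<open>\<Delta>\<close> = (1 - z/r) Q with Q zero-free in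
  the closed disc, so 1 / (1 - T) = V P with P = (1 - z/r)^(-1/2) and V tame. The constant v is V(r)
  times that of P, and V(r) is nonzero because V^2 Q = 1.\<close>

lemma sqrt_singularity_aux:
  "\<exists>v. v \<noteq> 0 \<and>
    (\<forall>H. tame r H \<longrightarrow> (\<lambda>n. (H * inverse (1 - T)) $ n * r ^ n * sqrt n) \<longlonglongrightarrow> ev r H * v)"
proof -
  obtain q where q: "\<Delta> = [:- r, 1:] * q"
    using root by (auto simp: poly_eq_0_iff_dvd)
  define Q where "Q = smult (- r) q"
  have "[:- r, 1:] = smult (- r) [:1, - 1 / r:]" using r by simp
  then have Q: "\<Delta> = [:1, - 1 / r:] * Q"
    by (simp only: q Q_def mult_smult_left mult_smult_right)
  have "pderiv \<Delta> = [:1, - 1 / r:] * pderiv Q + Q * [:- 1 / r:]"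
    unfolding Q by (subst pderiv_mult) (simp add: pderiv_pCons)
  then have Qr: "poly Q r \<noteq> 0" using simple_root r by simp
  have Qnz: "poly (map_poly complex_of_real Q) z \<noteq> 0" if "norm z \<le> r" for z
  proof (cases "z = of_real r")
    case True
    have "poly (map_poly complex_of_real Q) (of_real r) = of_real (poly Q r)"
      unfolding poly_map_poly_of_real by (simp add: poly_altdef)
    then show ?thesis using Qr True by simp
  next
    case False
    then show ?thesis using poly_nonzero_disc[OF that False]
      unfolding Q map_poly_complex_of_real_mult by auto
  qed
  obtain P \<kappa> where P: "P * P * (1 - fps_const (1 / r) * fps_X) = 1" "P $ 0 = 1"
    "(\<lambda>n. P $ n * r ^ n * sqrt n) \<longlonglongrightarrow> \<kappa>" "\<kappa> \<noteq> 0"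
    using inverse_sqrt_linear_fps[OF r] .
  define Y where "Y = inverse (1 - T)"
  have Y: "Y * (1 - T) = 1" unfolding Y_def by (rule inverse_mult_eq_1) (simp add: T0)
  define V where "V = Y * inverse P"
  have iP: "inverse P * P = 1" by (rule inverse_mult_eq_1) (simp add: P)
  have VP: "V * P = Y" using iP by (simp add: V_def mult.assoc)
  have \<Delta>Q: "fps_of_poly \<Delta> = (1 - fps_const (1 / r) * fps_X) * fps_of_poly Q"
    unfolding Q by (simp add: fps_of_poly_mult fps_of_poly_linear' flip: fps_const_neg)
  have "V * V * fps_of_poly Q = V * V * fps_of_poly Q * (P * P * (1 - fps_const (1 / r) * fps_X))"
    by (simp add: P)
  also have "\<dots> = (V * P) * (V * P) * fps_of_poly \<Delta>" by (simp only: \<Delta>Q mult_ac)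
  also have "\<dots> = Y * Y * ((1 - T) * (1 - T))" by (simp only: VP square)
  also have "\<dots> = (Y * (1 - T)) * (Y * (1 - T))" by (simp only: mult_ac)
  finally have V: "V * V * fps_of_poly Q = 1" by (simp add: Y)
  have tV: "tame r V" by (rule tame_inverse_sqrt_poly[OF r V Qnz])
  have "ev r V * ev r V * poly Q r = 1"
    using arg_cong[OF V, of "ev r"] tV by (simp add: ev_mult tame_mult tame_fps_of_poly ev_fps_of_poly)
  then have "ev r V \<noteq> 0" by auto
  moreover have "(\<lambda>n. (H * inverse (1 - T)) $ n * r ^ n * sqrt n) \<longlonglongrightarrow> ev r H * (ev r V * \<kappa>)"
    if "tame r H" for H
    using fps_convolution_inverse_sqrt[OF tame_mult[OF that tV] P(3)] that tV
    by (simp add: ev_mult VP mult.assoc flip: Y_def)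
  ultimately show ?thesis using P(4) by (intro exI[of _ "ev r V * \<kappa>"]) auto
qed

text \<open>Differentiating (1 - T)^2 = \<open>\<Delta>\<close> gives z T' = H / (1 - T) with H = -
  z \<open>\<Delta>\<close>' / 2. So the coefficients of T obey a law with the same v, which later
  cancels in the ratio; divided by sqrt n, this law also shows that T is tame.\<close>

theorem sqrt_singularity:
  "tame r T" "ev r T = 1"
  "\<exists>v. v \<noteq> 0 \<and>
    (\<forall>H. tame r H \<longrightarrow> (\<lambda>n. (H * inverse (1 - T)) $ n * r ^ n * sqrt n) \<longlonglongrightarrow> ev r H * v) \<and>
    (\<lambda>n. real n * (T $ n * r ^ n) * sqrt n) \<longlonglongrightarrow> - r * poly (pderiv \<Delta>) r / 2 * v"
proof -
  obtain v where v: "v \<noteq> 0"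
    "\<And>H. tame r H \<Longrightarrow> (\<lambda>n. (H * inverse (1 - T)) $ n * r ^ n * sqrt n) \<longlonglongrightarrow> ev r H * v"
    using sqrt_singularity_aux by blast
  define H where "H = fps_of_poly ([:0, -1/2:] * pderiv \<Delta>)"
  have Y: "(1 - T) * inverse (1 - T) = 1" by (rule inverse_mult_eq_1') (simp add: T0)
  have "fps_deriv (fps_of_poly \<Delta>) = - 2 * (fps_deriv T * (1 - T))"
    unfolding square[symmetric] by (simp add: algebra_simps)
  then have "fps_deriv (fps_of_poly \<Delta>) * inverse (1 - T) = (- 2 * (fps_deriv T * (1 - T))) * inverse (1 - T)"
    by (simp only:)
  then have "fps_deriv (fps_of_poly \<Delta>) * inverse (1 - T) = - 2 * fps_deriv T * ((1 - T) * inverse (1 - T))"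
    by (simp only: mult_ac)
  then have d: "fps_of_poly (pderiv \<Delta>) * inverse (1 - T) = - 2 * fps_deriv T"
    unfolding Y by (simp add: fps_of_poly_pderiv)
  have X: "fps_of_poly [:0, -1/2 :: real:] = fps_const (-1/2) * fps_X"
    by (simp add: fps_of_poly_pCons)
  have "H * inverse (1 - T) = fps_const (-1/2) * fps_X * (fps_of_poly (pderiv \<Delta>) * inverse (1 - T))"
    unfolding H_def fps_of_poly_mult X by (simp only: mult.assoc)
  also have "\<dots> = fps_X * fps_deriv T * (fps_const (-1/2) * (-2))"
    unfolding d by (simp only: mult_ac)
  also have "fps_const (-1/2) * (-2) = (1 :: real fps)"
    by (simp add: fps_eq_iff fps_numeral_nth)
  finally have HT: "H * inverse (1 - T) = fps_X * fps_deriv T" by simp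
  have HTn: "(H * inverse (1 - T)) $ n = real n * T $ n" for n
    unfolding HT by (cases n) auto
  have "tame r H" by (simp only: H_def tame_fps_of_poly)
  from v(2)[OF this] have lim: "(\<lambda>n. real n * (T $ n * r ^ n) * sqrt n) \<longlonglongrightarrow> - r * poly (pderiv \<Delta>) r / 2 * v"
    unfolding HTn by (simp add: H_def ev_fps_of_poly mult_ac)
  have "(\<lambda>n. real n * (T $ n * r ^ n) * sqrt n * (1 / sqrt n)) \<longlonglongrightarrow> - r * poly (pderiv \<Delta>) r / 2 * v * 0"
    by (intro tendsto_mult lim) real_asymp
  moreover have "\<forall>\<^sub>F n in sequentially. real n * (T $ n * r ^ n) * sqrt n * (1 / sqrt n) = real n * (T $ n * r ^ n)"
    using eventually_gt_at_top[of 0] by eventually_elim simp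
  ultimately have "(\<lambda>n. real n * (T $ n * r ^ n)) \<longlonglongrightarrow> - r * poly (pderiv \<Delta>) r / 2 * v * 0"
    by (rule Lim_transform_eventually)
  then show "tame r T" using abs_summable_T by (simp add: tame_def)
  show "ev r T = 1" by (simp add: ev_def suminf_T)
  show "\<exists>v. v \<noteq> 0 \<and>
    (\<forall>H. tame r H \<longrightarrow> (\<lambda>n. (H * inverse (1 - T)) $ n * r ^ n * sqrt n) \<longlonglongrightarrow> ev r H * v) \<and>
    (\<lambda>n. real n * (T $ n * r ^ n) * sqrt n) \<longlonglongrightarrow> - r * poly (pderiv \<Delta>) r / 2 * v"
    using v lim by blast
qed

end

section \<open>First, Last and Follow\<close>

definition adj :: "'a list \<Rightarrow> ('a \<times> 'a) set" where
  "adj w = {(i, j). \<exists>u v. w = u @ [i, j] @ v}"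

lemma adj_Nil [simp]: "adj [] = {}"
  by (simp add: adj_def)

lemma adj_Cons: "adj (x # w) = adj w \<union> (if w = [] then {} else {(x, hd w)})"
proof -
  have "(\<exists>u v. x # w = u @ [i, j] @ v) \<longleftrightarrow> (\<exists>u v. w = u @ [i, j] @ v) \<or> (i = x \<and> w \<noteq> [] \<and> j = hd w)" for i j
  proof
    assume "\<exists>u v. x # w = u @ [i, j] @ v"
    then obtain u v where "x # w = u @ [i, j] @ v" by blast
    then show "(\<exists>u v. w = u @ [i, j] @ v) \<or> (i = x \<and> w \<noteq> [] \<and> j = hd w)"
      by (cases u) auto
  next
    assume "(\<exists>u v. w = u @ [i, j] @ v) \<or> (i = x \<and> w \<noteq> [] \<and> j = hd w)"
    then show "\<exists>u v. x # w = u @ [i, j] @ v"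
    proof
      assume "\<exists>u v. w = u @ [i, j] @ v"
      then show ?thesis by (metis append_Cons)
    next
      assume "i = x \<and> w \<noteq> [] \<and> j = hd w"
      then have "x # w = [] @ [i, j] @ tl w" by simp
      then show ?thesis by blast
    qed
  qed
  then show ?thesis by (auto simp: adj_def)
qed

lemma adj_append:
  "adj (v @ w) = adj v \<union> adj w \<union> (if v = [] \<or> w = [] then {} else {(last v, hd w)})"
  by (induction v) (auto simp: adj_Cons)

definition firsts :: "'a list set \<Rightarrow> 'a set" where
  "firsts A = {hd w | w. w \<in> A \<and> w \<noteq> []}"

definition lasts :: "'a list set \<Rightarrow> 'a set" where
  "lasts A = {last w | w. w \<in> A \<and> w \<noteq> []}"

definition pairs :: "'a list set \<Rightarrow> ('a \<times> 'a) set" where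
  "pairs A = (\<Union>w\<in>A. adj w)"

lemma firstsI: "w \<in> A \<Longrightarrow> w \<noteq> [] \<Longrightarrow> hd w \<in> firsts A"
  by (auto simp: firsts_def)

lemma lastsI: "w \<in> A \<Longrightarrow> w \<noteq> [] \<Longrightarrow> last w \<in> lasts A"
  by (auto simp: lasts_def)

lemma firsts_conc:
  assumes "B \<noteq> {}"
  shows "firsts (conc A B) = firsts A \<union> (if [] \<in> A then firsts B else {})"
proof (intro set_eqI iffI)
  fix x assume "x \<in> firsts (conc A B)"
  then obtain u v where "u \<in> A" "v \<in> B" "u @ v \<noteq> []" "x = hd (u @ v)"
    by (auto simp: firsts_def conc_def)
  then show "x \<in> firsts A \<union> (if [] \<in> A then firsts B else {})"
    by (cases "u = []") (auto intro: firstsI)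
next
  fix x assume "x \<in> firsts A \<union> (if [] \<in> A then firsts B else {})"
  then consider u where "u \<in> A" "u \<noteq> []" "x = hd u" | v where "[] \<in> A" "v \<in> B" "v \<noteq> []" "x = hd v"
    by (auto simp: firsts_def split: if_splits)
  then show "x \<in> firsts (conc A B)"
  proof cases
    case 1
    obtain v where "v \<in> B" using assms by blast
    then have "u @ v \<in> conc A B" using 1 by (auto simp: conc_def)
    then show ?thesis using firstsI[of "u @ v"] 1 by simp
  next
    case 2
    then have "[] @ v \<in> conc A B" unfolding conc_def by blast
    then show ?thesis using firstsI[of "[] @ v"] 2 by simp
  qed
qed

lemma lasts_conc:
  assumes "A \<noteq> {}"
  shows "lasts (conc A B) = (if [] \<in> B then lasts A else {}) \<union> lasts B"
proof (intro set_eqI iffI)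
  fix x assume "x \<in> lasts (conc A B)"
  then obtain u v where "u \<in> A" "v \<in> B" "u @ v \<noteq> []" "x = last (u @ v)"
    by (auto simp: lasts_def conc_def)
  then show "x \<in> (if [] \<in> B then lasts A else {}) \<union> lasts B"
    by (cases "v = []") (auto intro: lastsI)
next
  fix x assume "x \<in> (if [] \<in> B then lasts A else {}) \<union> lasts B"
  then consider v where "v \<in> B" "v \<noteq> []" "x = last v" | u where "[] \<in> B" "u \<in> A" "u \<noteq> []" "x = last u"
    by (auto simp: lasts_def split: if_splits)
  then show "x \<in> lasts (conc A B)"
  proof cases
    case 1
    obtain u where "u \<in> A" using assms by blast
    then have "u @ v \<in> conc A B" using 1 by (auto simp: conc_def)
    then show ?thesis using lastsI[of "u @ v"] 1 by simp
  next
    case 2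
    then have "u @ [] \<in> conc A B" unfolding conc_def by blast
    then show ?thesis using lastsI[of "u @ []"] 2 by simp
  qed
qed

lemma pairs_conc:
  assumes "A \<noteq> {}" "B \<noteq> {}"
  shows "pairs (conc A B) = pairs A \<union> pairs B \<union> lasts A \<times> firsts B"
proof
  show "pairs (conc A B) \<subseteq> pairs A \<union> pairs B \<union> lasts A \<times> firsts B"
    by (auto simp: pairs_def conc_def adj_append intro: firstsI lastsI split: if_splits)
  have w: "u @ v \<in> conc A B" if "u \<in> A" "v \<in> B" for u v using that by (auto simp: conc_def)
  have "adj u \<subseteq> pairs (conc A B)" if "u \<in> A" for u
  proof -
    obtain v where "v \<in> B" using assms(2) by blast
    from w[OF that this] show ?thesis unfolding pairs_def
      by (rule order_trans[rotated, OF UN_upper]) (auto simp: adj_append)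
  qed
  moreover have "adj v \<subseteq> pairs (conc A B)" if "v \<in> B" for v
  proof -
    obtain u where "u \<in> A" using assms(1) by blast
    from w[OF this that] show ?thesis unfolding pairs_def
      by (rule order_trans[rotated, OF UN_upper]) (auto simp: adj_append)
  qed
  moreover have "(last u, hd v) \<in> pairs (conc A B)" if "u \<in> A" "u \<noteq> []" "v \<in> B" "v \<noteq> []" for u v
    using w[OF that(1,3)] that by (auto simp: pairs_def adj_append intro!: bexI[of _ "u @ v"])
  ultimately show "pairs A \<union> pairs B \<union> lasts A \<times> firsts B \<subseteq> pairs (conc A B)"
    by (auto simp: pairs_def firsts_def lasts_def)
qed

lemma kstar_single: "w \<in> A \<Longrightarrow> w \<in> kstar A"
  using kstar_app[OF _ kstar_Nil] by fastforce

text \<open>One induction for ends and adjacent pairs, since the pair at the seam of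
  \<open>u @ v\<close> needs \<open>hd v\<close> to be known as a first letter of
  \<open>A\<close>.\<close>

lemma kstar_word:
  assumes "w \<in> kstar A"
  shows "(w \<noteq> [] \<longrightarrow> hd w \<in> firsts A \<and> last w \<in> lasts A) \<and> adj w \<subseteq> pairs A \<union> lasts A \<times> firsts A"
  using assms
proof induction
  case (kstar_app u v)
  then show ?case
    by (cases "u = []"; cases "v = []")
       (auto simp: adj_append pairs_def intro: firstsI lastsI)
qed simp

lemma firsts_kstar: "firsts (kstar A) = firsts A"
  using kstar_word[of _ A] by (fastforce simp: firsts_def intro: kstar_single)

lemma lasts_kstar: "lasts (kstar A) = lasts A"
  using kstar_word[of _ A] by (fastforce simp: lasts_def intro: kstar_single)

lemma pairs_kstar: "pairs (kstar A) = pairs A \<union> lasts A \<times> firsts A"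
proof
  show "pairs (kstar A) \<subseteq> pairs A \<union> lasts A \<times> firsts A"
    using kstar_word[of _ A] by (auto simp: pairs_def)
  have "(last u, hd v) \<in> pairs (kstar A)" if "u \<in> A" "u \<noteq> []" "v \<in> A" "v \<noteq> []" for u v
    using kstar_app[OF that(1) kstar_single[OF that(3)]] that
    by (auto simp: pairs_def adj_append intro!: bexI[of _ "u @ v"])
  then show "pairs A \<union> lasts A \<times> firsts A \<subseteq> pairs (kstar A)"
    by (auto simp: pairs_def firsts_def lasts_def intro: kstar_single)
qed

lemma firsts_Un: "firsts (A \<union> B) = firsts A \<union> firsts B" by (auto simp: firsts_def)
lemma lasts_Un: "lasts (A \<union> B) = lasts A \<union> lasts B" by (auto simp: lasts_def)
lemma pairs_Un: "pairs (A \<union> B) = pairs A \<union> pairs B" by (auto simp: pairs_def)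

lemma lang_nonempty: "lang \<beta> \<noteq> {}"
  by (induction \<beta>) (auto simp: conc_def intro: kstar_Nil)

lemma lang_letters: "w \<in> lang \<beta> \<Longrightarrow> set w \<subseteq> set (letters \<beta>)"
proof (induction \<beta> arbitrary: w)
  case (Times a b)
  then show ?case by (fastforce simp: conc_def)
next
  case (Star a)
  from Star.prems have "w \<in> kstar (lang a)" by simp
  then show ?case by induction (use Star.IH in auto)
qed auto

section \<open>Recursive counts for the Glushkov automaton\<close>

fun nullable :: "rexp \<Rightarrow> bool" where
  "nullable Eps = True"
| "nullable (Sym a) = False"
| "nullable (Plus a b) = (nullable a \<or> nullable b)"
| "nullable (Times a b) = (nullable a \<and> nullable b)"
| "nullable (Star a) = True"

fun nfirst :: "rexp \<Rightarrow> nat" where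
  "nfirst Eps = 0"
| "nfirst (Sym a) = 1"
| "nfirst (Plus a b) = nfirst a + nfirst b"
| "nfirst (Times a b) = nfirst a + (if nullable a then nfirst b else 0)"
| "nfirst (Star a) = nfirst a"

fun nlast :: "rexp \<Rightarrow> nat" where
  "nlast Eps = 0"
| "nlast (Sym a) = 1"
| "nlast (Plus a b) = nlast a + nlast b"
| "nlast (Times a b) = (if nullable b then nlast a else 0) + nlast b"
| "nlast (Star a) = nlast a"

text \<open>\<open>nloop \<beta>\<close> is the size of \<open>Follow(\<beta>\<^sup>\<star>) = Follow(\<beta>) \<union> Last(\<beta>) \<times> First(\<beta>)\<close>; the union is not
  disjoint, and this count has a recursion of its own.\<close>

fun nfollow :: "rexp \<Rightarrow> nat" and nloop :: "rexp \<Rightarrow> nat" where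
  "nfollow Eps = 0"
| "nfollow (Sym a) = 0"
| "nfollow (Plus a b) = nfollow a + nfollow b"
| "nfollow (Times a b) = nfollow a + nfollow b + nlast a * nfirst b"
| "nfollow (Star a) = nloop a"
| "nloop Eps = 0"
| "nloop (Sym a) = 1"
| "nloop (Plus a b) = nloop a + nloop b + nlast a * nfirst b + nlast b * nfirst a"
| "nloop (Times a b) = (if nullable b then nloop a else nfollow a)
     + (if nullable a then nloop b else nfollow b) + nlast a * nfirst b + nlast b * nfirst a"
| "nloop (Star a) = nloop a"

lemma nullable_iff: "[] \<in> lang (mark i \<beta>) \<longleftrightarrow> nullable \<beta>"
  by (induction \<beta> arbitrary: i) (auto simp: conc_def intro: kstar_Nil)

text \<open>The operands of a union or concatenation receive consecutive, hence disjoint, intervals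
  of positions; this is why their contributions can be counted separately.\<close>

lemma letters_mark: "letters (mark i \<beta>) = [i..<i + length (letters \<beta>)]"
proof -
  have "[i..<i + m] @ [i + m..<i + (m + n)] = [i..<i + (m + n)]" for i m n
    using upt_add_eq_append[of i "i + m" n] by (simp add: add.assoc)
  then show ?thesis by (induction \<beta> arbitrary: i) (auto simp: add.assoc)
qed

lemma in_firsts_mark: "firsts (lang (mark i \<beta>)) \<subseteq> {i..<i + length (letters \<beta>)}"
  using lang_letters[of _ "mark i \<beta>"] by (force simp: firsts_def letters_mark)

lemma in_lasts_mark: "lasts (lang (mark i \<beta>)) \<subseteq> {i..<i + length (letters \<beta>)}"
  using lang_letters[of _ "mark i \<beta>"] by (force simp: lasts_def letters_mark)

lemma in_pairs_mark:
  "pairs (lang (mark i \<beta>)) \<subseteq> {i..<i + length (letters \<beta>)} \<times> {i..<i + length (letters \<beta>)}"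
  using lang_letters[of _ "mark i \<beta>"] by (force simp: pairs_def adj_def letters_mark)

text \<open>The four sets lie in the disjoint blocks A x A, B x B, A x B and B x A.\<close>

lemma card_blocks:
  assumes "P \<subseteq> A \<times> A" "Q \<subseteq> B \<times> B" "U \<subseteq> A" "V \<subseteq> A" "W \<subseteq> B" "Z \<subseteq> B"
    and "A \<inter> B = {}" "finite A" "finite B"
  shows "card (P \<union> Q) = card P + card Q"
    and "card (P \<union> Q \<union> U \<times> W) = card P + card Q + card U * card W"
    and "card (P \<union> Q \<union> U \<times> W \<union> Z \<times> V) = card P + card Q + card U * card W + card Z * card V"
proof -
  have fin: "finite P" "finite Q" "finite (U \<times> W)" "finite (Z \<times> V)"
    using finite_subset[OF assms(1)] finite_subset[OF assms(2)] finite_subset[OF assms(3)]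
      finite_subset[OF assms(4)] finite_subset[OF assms(5)] finite_subset[OF assms(6)] assms(8,9) by auto
  show 1: "card (P \<union> Q) = card P + card Q"
    using assms fin by (intro card_Un_disjoint) auto
  have 2: "card (P \<union> Q \<union> U \<times> W) = card (P \<union> Q) + card (U \<times> W)"
    using assms fin by (intro card_Un_disjoint) auto
  have "card (P \<union> Q \<union> U \<times> W \<union> Z \<times> V) = card (P \<union> Q \<union> U \<times> W) + card (Z \<times> V)"
    using assms fin by (intro card_Un_disjoint) auto
  then show "card (P \<union> Q \<union> U \<times> W \<union> Z \<times> V) = card P + card Q + card U * card W + card Z * card V"
    and "card (P \<union> Q \<union> U \<times> W) = card P + card Q + card U * card W"
    by (simp_all add: 1 2 card_cartesian_product)
qed

lemma card_firsts_mark: "card (firsts (lang (mark i \<beta>))) = nfirst \<beta>"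
proof (induction \<beta> arbitrary: i)
  case (Plus a b)
  have "firsts (lang (mark i a)) \<inter> firsts (lang (mark (i + length (letters a)) b)) = {}"
    using in_firsts_mark[of i a] in_firsts_mark[of "i + length (letters a)" b] by force
  then show ?case
    using Plus finite_subset[OF in_firsts_mark] by (simp add: firsts_Un card_Un_disjoint)
next
  case (Times a b)
  have "firsts (lang (mark i a)) \<inter> firsts (lang (mark (i + length (letters a)) b)) = {}"
    using in_firsts_mark[of i a] in_firsts_mark[of "i + length (letters a)" b] by force
  then show ?case
    using Times finite_subset[OF in_firsts_mark]
    by (simp add: firsts_conc lang_nonempty nullable_iff card_Un_disjoint)
qed (simp_all add: firsts_def firsts_kstar[unfolded firsts_def])

lemma card_lasts_mark: "card (lasts (lang (mark i \<beta>))) = nlast \<beta>"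
proof (induction \<beta> arbitrary: i)
  case (Plus a b)
  have "lasts (lang (mark i a)) \<inter> lasts (lang (mark (i + length (letters a)) b)) = {}"
    using in_lasts_mark[of i a] in_lasts_mark[of "i + length (letters a)" b] by force
  then show ?case
    using Plus finite_subset[OF in_lasts_mark] by (simp add: lasts_Un card_Un_disjoint)
next
  case (Times a b)
  have "lasts (lang (mark i a)) \<inter> lasts (lang (mark (i + length (letters a)) b)) = {}"
    using in_lasts_mark[of i a] in_lasts_mark[of "i + length (letters a)" b] by force
  then show ?case
    using Times finite_subset[OF in_lasts_mark]
    by (simp add: lasts_conc lang_nonempty nullable_iff card_Un_disjoint)
qed (simp_all add: lasts_def lasts_kstar[unfolded lasts_def])

text \<open>The induction is simultaneous: Follow of a star is the looped count, and the looped
  count of a concatenation refers to both counts of its operands.\<close>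

lemma card_pairs_mark:
  "card (pairs (lang (mark i \<beta>))) = nfollow \<beta> \<and> card (pairs (kstar (lang (mark i \<beta>)))) = nloop \<beta>"
proof (induction \<beta> arbitrary: i)
  case Eps
  show ?case by (simp add: pairs_kstar) (simp add: pairs_def lasts_def firsts_def)
next
  case (Sym a)
  have "lasts {[i]} = {i}" "firsts {[i]} = {i}" "pairs {[i]} = {}"
    by (simp_all add: lasts_def firsts_def pairs_def adj_Cons)
  then show ?case by (simp add: pairs_kstar)
next
  case (Star a)
  have "pairs (kstar (kstar A)) = pairs (kstar A)" for A :: "nat list set"
    by (auto simp: pairs_kstar lasts_kstar firsts_kstar)
  then show ?case using Star by simp
next
  case (Plus a b)
  let ?i = "i + length (letters a)"
  let ?A = "lang (mark i a)" and ?B = "lang (mark ?i b)"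
  let ?I = "{i..<?i}" and ?J = "{?i..<?i + length (letters b)}"
  note sub = in_firsts_mark[of i a] in_firsts_mark[of ?i b] in_lasts_mark[of i a] in_lasts_mark[of ?i b]
    in_pairs_mark[of i a] in_pairs_mark[of ?i b]
  have kA: "pairs (kstar ?A) \<subseteq> ?I \<times> ?I" and kB: "pairs (kstar ?B) \<subseteq> ?J \<times> ?J"
    using sub unfolding pairs_kstar by blast+
  have "?I \<inter> ?J = {}" by auto
  note blocks = card_blocks[OF _ _ sub(3,1,2,4) this, simplified]
  have "pairs (kstar (?A \<union> ?B)) = pairs (kstar ?A) \<union> pairs (kstar ?B) \<union> lasts ?A \<times> firsts ?B \<union> lasts ?B \<times> firsts ?A"
    by (auto simp: pairs_kstar pairs_Un lasts_Un firsts_Un)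
  then show ?case
    using blocks(3)[OF kA kB] blocks(1)[OF sub(5,6)] Plus
    by (simp add: pairs_Un card_firsts_mark card_lasts_mark)
next
  case (Times a b)
  let ?i = "i + length (letters a)"
  let ?A = "lang (mark i a)" and ?B = "lang (mark ?i b)"
  let ?I = "{i..<?i}" and ?J = "{?i..<?i + length (letters b)}"
  note sub = in_firsts_mark[of i a] in_firsts_mark[of ?i b] in_lasts_mark[of i a] in_lasts_mark[of ?i b]
    in_pairs_mark[of i a] in_pairs_mark[of ?i b]
  have kA: "pairs (kstar ?A) \<subseteq> ?I \<times> ?I" and kB: "pairs (kstar ?B) \<subseteq> ?J \<times> ?J"
    using sub unfolding pairs_kstar by blast+
  have "?I \<inter> ?J = {}" by auto
  note blocks = card_blocks[OF _ _ sub(3,1,2,4) this, simplified]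
  \<comment> \<open>Within the positions of \<open>a\<close>, Last x First of the concatenation is
    that of \<open>a\<close> if \<open>b\<close> is nullable, and empty otherwise; symmetrically for
    \<open>b\<close>.\<close>
  let ?A' = "if nullable b then pairs (kstar ?A) else pairs ?A"
  let ?B' = "if nullable a then pairs (kstar ?B) else pairs ?B"
  have "pairs (kstar (conc ?A ?B)) = ?A' \<union> ?B' \<union> lasts ?A \<times> firsts ?B \<union> lasts ?B \<times> firsts ?A"
    by (auto simp: pairs_kstar pairs_conc lasts_conc firsts_conc lang_nonempty nullable_iff split: if_splits)
  moreover have "?A' \<subseteq> ?I \<times> ?I" "?B' \<subseteq> ?J \<times> ?J" using kA kB sub(5,6) by auto
  ultimately show ?case
    using blocks(3)[of ?A' ?B'] blocks(2)[OF sub(5,6)] Times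
    by (simp add: pairs_conc lang_nonempty card_firsts_mark card_lasts_mark split del: if_split) (simp split: if_split)
qed

lemma glushkov_transitions_eq: "glushkov_transitions \<beta> = nfirst \<beta> + nfollow \<beta>"
proof -
  have "First \<beta> = firsts (lang (mark 1 \<beta>))" by (auto simp: First_def marked_def firsts_def)
  moreover have "Follow \<beta> = pairs (lang (mark 1 \<beta>))"
    by (auto simp: Follow_def marked_def pairs_def adj_def)
  ultimately show ?thesis
    by (simp add: glushkov_transitions_def card_firsts_mark card_pairs_mark)
qed

section \<open>Generating functions\<close>

definition level :: "rexp set \<Rightarrow> nat \<Rightarrow> rexp set" where
  "level A n = {\<beta> \<in> A. rsize \<beta> = n}"

definition gf :: "rexp set \<Rightarrow> (rexp \<Rightarrow> real) \<Rightarrow> real fps" where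
  "gf A w = Abs_fps (\<lambda>n. \<Sum>\<beta>\<in>level A n. w \<beta>)"

definition gf2 :: "rexp set \<Rightarrow> (rexp \<Rightarrow> rexp \<Rightarrow> real) \<Rightarrow> real fps" where
  "gf2 A w = Abs_fps (\<lambda>n. \<Sum>(a, b)\<in>{(a, b). a \<in> A \<and> b \<in> A \<and> rsize a + rsize b = n}. w a b)"

definition over :: "nat \<Rightarrow> rexp set" where
  "over k = {\<beta>. set (letters \<beta>) \<subseteq> {..<k}}"

lemma finite_over: "finite {\<beta> \<in> over k. rsize \<beta> \<le> n}"
proof (induction n)
  case 0
  have "rsize \<beta> > 0" for \<beta> by (induction \<beta>) auto
  then have "{\<beta> \<in> over k. rsize \<beta> \<le> 0} = {}" by auto
  then show ?case by (simp only: finite.emptyI)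
next
  case (Suc n)
  let ?S = "{\<beta> \<in> over k. rsize \<beta> \<le> n}"
  have "{\<beta> \<in> over k. rsize \<beta> \<le> Suc n} \<subseteq> {Eps} \<union> Sym ` {..<k} \<union> (\<lambda>(a, b). Plus a b) ` (?S \<times> ?S)
     \<union> (\<lambda>(a, b). Times a b) ` (?S \<times> ?S) \<union> Star ` ?S"
  proof
    fix \<beta> assume "\<beta> \<in> {\<beta> \<in> over k. rsize \<beta> \<le> Suc n}"
    then show "\<beta> \<in> {Eps} \<union> Sym ` {..<k} \<union> (\<lambda>(a, b). Plus a b) ` (?S \<times> ?S)
     \<union> (\<lambda>(a, b). Times a b) ` (?S \<times> ?S) \<union> Star ` ?S"
      by (cases \<beta>) (auto simp: over_def image_iff)
  qed
  then show ?case by (rule finite_subset) (use Suc in auto)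
qed

lemma finite_level: "A \<subseteq> over k \<Longrightarrow> finite (level A n)"
  by (rule finite_subset[OF _ finite_over[of k n]]) (auto simp: level_def)

lemma finite_level2:
  assumes "A \<subseteq> over k"
  shows "finite {(a, b). a \<in> A \<and> b \<in> A \<and> rsize a + rsize b = n}"
proof (rule finite_subset)
  show "{(a, b). a \<in> A \<and> b \<in> A \<and> rsize a + rsize b = n}
    \<subseteq> {\<beta> \<in> over k. rsize \<beta> \<le> n} \<times> {\<beta> \<in> over k. rsize \<beta> \<le> n}" using assms by auto
qed (intro finite_cartesian_product finite_over)

lemma gf_cong: "(\<And>\<beta>. \<beta> \<in> A \<Longrightarrow> u \<beta> = v \<beta>) \<Longrightarrow> gf A u = gf A v"
  by (auto simp: gf_def fps_eq_iff level_def intro!: sum.cong)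

lemma gf_diff: "gf A (\<lambda>\<beta>. u \<beta> - v \<beta>) = gf A u - gf A v"
  by (simp add: gf_def fps_eq_iff sum_subtractf)

lemma gf_const: "gf A (\<lambda>_. c) = fps_const c * gf A (\<lambda>_. 1)"
  by (simp add: gf_def fps_eq_iff)

lemma gf_nonneg: "(\<And>\<beta>. \<beta> \<in> A \<Longrightarrow> u \<beta> \<ge> 0) \<Longrightarrow> fps_nth (gf A u) n \<ge> 0"
  by (auto simp: gf_def level_def intro!: sum_nonneg)

lemma gf_Diff_set:
  assumes "B \<subseteq> A" "A \<subseteq> over k"
  shows "gf (A - B) u = gf A u - gf B u"
proof -
  have "level (A - B) n = level A n - level B n" for n by (auto simp: level_def)
  moreover have "level B n \<subseteq> level A n" for n using assms by (auto simp: level_def)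
  ultimately show ?thesis
    using finite_level[OF assms(2)] by (simp add: gf_def fps_eq_iff sum_diff)
qed

lemma gf2_add: "gf2 A (\<lambda>a b. u a b + v a b) = gf2 A u + gf2 A v"
  by (simp add: gf2_def fps_eq_iff sum.distrib case_prod_unfold)

lemma gf2_diff: "gf2 A (\<lambda>a b. u a b - v a b) = gf2 A u - gf2 A v"
  by (simp add: gf2_def fps_eq_iff sum_subtractf case_prod_unfold)

text \<open>Cauchy product. The pair weights below are rewritten as sums of products, conditionals
  through the indicator of non-nullability, so that this rule yields polynomial equations.\<close>

lemma gf2_prod:
  assumes A: "A \<subseteq> over k"
  shows "gf2 A (\<lambda>a b. u a * v b) = gf A u * gf A v"
proof (rule fps_ext)
  fix n
  have "(\<Sum>(a, b)\<in>{(a, b). a \<in> A \<and> b \<in> A \<and> rsize a + rsize b = n}. u a * v b)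
     = (\<Sum>(a, b)\<in>(\<Union>i\<in>{0..n}. level A i \<times> level A (n - i)). u a * v b)"
    by (intro sum.cong) (auto simp: level_def)
  also have "\<dots> = (\<Sum>i=0..n. \<Sum>(a, b)\<in>level A i \<times> level A (n - i). u a * v b)"
    by (rule sum.UNION_disjoint)
       (use finite_level[OF A] in \<open>auto simp: level_def\<close>)
  also have "\<dots> = (\<Sum>i=0..n. (\<Sum>a\<in>level A i. u a) * (\<Sum>b\<in>level A (n - i). v b))"
    by (simp add: sum_product sum.cartesian_product)
  finally show "fps_nth (gf2 A (\<lambda>a b. u a * v b)) n = fps_nth (gf A u * gf A v) n"
    by (simp add: gf2_def gf_def fps_mult_nth)
qed

lemma gf2_cong:
  "(\<And>a b. a \<in> A \<Longrightarrow> b \<in> A \<Longrightarrow> u a b = v a b) \<Longrightarrow> gf2 A u = gf2 A v"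
  by (auto simp: gf2_def fps_eq_iff intro!: sum.cong)

section \<open>Decomposition of the class by the top symbol\<close>

definition sigma_stars :: "nat \<Rightarrow> rexp set" where
  "sigma_stars k = {\<beta>. sigma_star k \<beta>}"

lemma RE_na_simps:
  "Eps \<in> RE_na k"
  "Sym x \<in> RE_na k \<longleftrightarrow> x < k"
  "Plus a b \<in> RE_na k \<longleftrightarrow> a \<in> RE_na k - sigma_stars k \<and> b \<in> RE_na k - sigma_stars k"
  "Times a b \<in> RE_na k \<longleftrightarrow> a \<in> RE_na k \<and> b \<in> RE_na k"
  "Star a \<in> RE_na k \<longleftrightarrow> a \<in> RE_na k"
proof -
  show "Eps \<in> RE_na k" "Sym x \<in> RE_na k \<longleftrightarrow> x < k" "Star a \<in> RE_na k \<longleftrightarrow> a \<in> RE_na k"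
    by (simp_all add: RE_na_def)
  show "Times a b \<in> RE_na k \<longleftrightarrow> a \<in> RE_na k \<and> b \<in> RE_na k"
    unfolding RE_na_def by (simp del: split_paired_All) blast
  show "Plus a b \<in> RE_na k \<longleftrightarrow> a \<in> RE_na k - sigma_stars k \<and> b \<in> RE_na k - sigma_stars k"
    unfolding RE_na_def sigma_stars_def by simp blast
qed

lemma RE_na_over: "RE_na k \<subseteq> over k"
  by (auto simp: RE_na_def over_def)

lemma subexps_union_tree: "union_tree t \<Longrightarrow> b \<in> subexps t \<Longrightarrow> union_tree b"
  by (induction t) auto

text \<open>A union tree contains no star, so no union inside it has a Sigma-star operand. By this
  inclusion the series of the admissible union operands is the difference R - S.\<close>

lemma sigma_stars_RE_na: "sigma_stars k \<subseteq> RE_na k"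
proof
  fix \<beta> assume "\<beta> \<in> sigma_stars k"
  then obtain t where t: "\<beta> = Star t" "union_tree t" "set (letters t) = {..<k}"
    by (auto simp: sigma_stars_def sigma_star_def)
  have "\<not> sigma_star k b1 \<and> \<not> sigma_star k b2" if "Plus b1 b2 \<in> subexps t" for b1 b2
  proof -
    have "union_tree b1" "union_tree b2" using subexps_union_tree[OF t(2) that] by simp_all
    moreover have "\<not> union_tree (Star x)" for x by simp
    ultimately show ?thesis unfolding sigma_star_def by blast
  qed
  then show "\<beta> \<in> RE_na k" unfolding RE_na_def t(1) by (simp add: t(3))
qed

lemma level_RE_na_Suc:
  fixes k m :: nat
  defines "R \<equiv> RE_na k" and "P \<equiv> RE_na k - sigma_stars k"
  shows "level R (Suc m) = (if m = 0 then insert Eps (Sym ` {..<k}) else {})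
    \<union> (\<lambda>(a, b). Plus a b) ` {(a, b). a \<in> P \<and> b \<in> P \<and> rsize a + rsize b = m}
    \<union> (\<lambda>(a, b). Times a b) ` {(a, b). a \<in> R \<and> b \<in> R \<and> rsize a + rsize b = m}
    \<union> Star ` level R m" (is "_ = ?r")
proof (rule set_eqI)
  fix \<beta>
  show "\<beta> \<in> level R (Suc m) \<longleftrightarrow> \<beta> \<in> ?r"
  proof (cases \<beta>)
    case Eps
    have "Eps \<in> level R (Suc m) \<longleftrightarrow> m = 0"
      by (simp add: level_def R_def RE_na_simps)
    also have "\<dots> \<longleftrightarrow> Eps \<in> ?r" by auto
    finally show ?thesis unfolding Eps .
  next
    case (Sym x)
    have "Sym x \<in> level R (Suc m) \<longleftrightarrow> x < k \<and> m = 0"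
      by (simp add: level_def R_def RE_na_simps)
    also have "\<dots> \<longleftrightarrow> Sym x \<in> ?r" by auto
    finally show ?thesis unfolding Sym .
  next
    case (Plus a b)
    have "Plus a b \<in> level R (Suc m) \<longleftrightarrow> a \<in> P \<and> b \<in> P \<and> rsize a + rsize b = m"
      by (simp add: level_def R_def P_def RE_na_simps)
    also have "\<dots> \<longleftrightarrow> Plus a b \<in> ?r" by auto
    finally show ?thesis unfolding Plus .
  next
    case (Times a b)
    have "Times a b \<in> level R (Suc m) \<longleftrightarrow> a \<in> R \<and> b \<in> R \<and> rsize a + rsize b = m"
      by (simp add: level_def R_def RE_na_simps)
    also have "\<dots> \<longleftrightarrow> Times a b \<in> ?r" by auto
    finally show ?thesis unfolding Times .
  next
    case (Star a)
    have "Star a \<in> level R (Suc m) \<longleftrightarrow> a \<in> level R m"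
      by (simp add: level_def R_def RE_na_simps)
    also have "\<dots> \<longleftrightarrow> Star a \<in> ?r" by auto
    finally show ?thesis unfolding Star .
  qed
qed

lemma gf_RE_na:
  fixes k :: nat
  defines "R \<equiv> RE_na k" and "P \<equiv> RE_na k - sigma_stars k"
  shows "gf R w = fps_X * (fps_const (w Eps + (\<Sum>a<k. w (Sym a))) + gf2 P (\<lambda>a b. w (Plus a b))
    + gf2 R (\<lambda>a b. w (Times a b)) + gf R (\<lambda>a. w (Star a)))"
proof (rule fps_ext)
  fix n
  have R: "R \<subseteq> over k" and P: "P \<subseteq> over k" using RE_na_over by (auto simp: R_def P_def)
  show "fps_nth (gf R w) n = fps_nth (fps_X * (fps_const (w Eps + (\<Sum>a<k. w (Sym a))) + gf2 P (\<lambda>a b. w (Plus a b))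
    + gf2 R (\<lambda>a b. w (Times a b)) + gf R (\<lambda>a. w (Star a)))) n"
  proof (cases n)
    case 0
    have "rsize \<beta> > 0" for \<beta> by (induction \<beta>) auto
    then have "level R 0 = {}" by (auto simp: level_def)
    then show ?thesis using 0 by (simp add: gf_def)
  next
    case (Suc m)
    let ?E = "if m = 0 then insert Eps (Sym ` {..<k}) else {}"
    let ?P2 = "{(a, b). a \<in> P \<and> b \<in> P \<and> rsize a + rsize b = m}"
    let ?R2 = "{(a, b). a \<in> R \<and> b \<in> R \<and> rsize a + rsize b = m}"
    have fin: "finite ?E" "finite ((\<lambda>(a, b). Plus a b) ` ?P2)" "finite ((\<lambda>(a, b). Times a b) ` ?R2)"
      "finite (Star ` level R m)"
      using finite_level2[OF R, of m] finite_level2[OF P, of m] finite_level[OF R, of m] by auto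
    have E: "sum w ?E = (if m = 0 then w Eps + (\<Sum>a<k. w (Sym a)) else 0)"
      by (auto simp: sum.insert sum.reindex inj_on_def image_iff)
    have un: "sum w (A \<union> B \<union> C \<union> D) = sum w A + sum w B + sum w C + sum w D"
      if "finite A" "finite B" "finite C" "finite D" "A \<inter> B = {}" "(A \<union> B) \<inter> C = {}" "(A \<union> B \<union> C) \<inter> D = {}"
      for A B C D :: "rexp set"
      using that by (simp add: sum.union_disjoint)
    have "level R (Suc m) = ?E \<union> (\<lambda>(a, b). Plus a b) ` ?P2 \<union> (\<lambda>(a, b). Times a b) ` ?R2 \<union> Star ` level R m"
      unfolding R_def P_def by (rule level_RE_na_Suc)
    moreover have "?E \<inter> (\<lambda>(a, b). Plus a b) ` ?P2 = {}"
      "(?E \<union> (\<lambda>(a, b). Plus a b) ` ?P2) \<inter> (\<lambda>(a, b). Times a b) ` ?R2 = {}"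
      "(?E \<union> (\<lambda>(a, b). Plus a b) ` ?P2 \<union> (\<lambda>(a, b). Times a b) ` ?R2) \<inter> Star ` level R m = {}"
      by auto
    note un[OF fin this]
    ultimately have "sum w (level R (Suc m)) = sum w ?E + sum w ((\<lambda>(a, b). Plus a b) ` ?P2)
      + sum w ((\<lambda>(a, b). Times a b) ` ?R2) + sum w (Star ` level R m)"
      by (simp only:)
    also have "sum w ((\<lambda>(a, b). Plus a b) ` ?P2) = (\<Sum>(a, b)\<in>?P2. w (Plus a b))"
      by (subst sum.reindex) (auto simp: inj_on_def case_prod_unfold comp_def)
    also have "sum w ((\<lambda>(a, b). Times a b) ` ?R2) = (\<Sum>(a, b)\<in>?R2. w (Times a b))"
      by (subst sum.reindex) (auto simp: inj_on_def case_prod_unfold comp_def)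
    also have "sum w (Star ` level R m) = (\<Sum>a\<in>level R m. w (Star a))"
      by (subst sum.reindex) (auto simp: inj_on_def)
    finally show ?thesis using Suc E by (simp add: gf_def gf2_def)
  qed
qed

lemma gf_RE_na_eqI:
  assumes "gf2 (RE_na k - sigma_stars k) (\<lambda>a b. w (Plus a b)) = p"
    and "gf2 (RE_na k) (\<lambda>a b. w (Times a b)) = t"
    and "gf (RE_na k) (\<lambda>a. w (Star a)) = s" and "w Eps + (\<Sum>a<k. w (Sym a)) = c"
  shows "gf (RE_na k) w = fps_X * (fps_const c + p + t + s)"
  using gf_RE_na[of k w] assms by simp

section \<open>Counting the Sigma-star expressions\<close>

text \<open>The preorder shape together with the left-to-right sequence of leaves determines a union tree.\<close>

fun shape :: "rexp \<Rightarrow> bool list" where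
  "shape (Plus a b) = True # shape a @ shape b"
| "shape _ = [False]"

text \<open>Shapes form a prefix code. The remainders \<open>u\<close>, \<open>l\<close> are carried
  along so that, once the left operands agree, the induction continues with the right ones.\<close>

lemma shape_letters_inject:
  assumes "union_tree t" "union_tree t'" "shape t @ u = shape t' @ u'" "letters t @ l = letters t' @ l'"
  shows "t = t' \<and> u = u' \<and> l = l'"
  using assms
proof (induction t arbitrary: t' u u' l l')
  case (Plus a b)
  from Plus.prems(2,3) obtain c d where t': "t' = Plus c d" by (cases t') auto
  have ut: "union_tree a" "union_tree b" "union_tree c" "union_tree d"
    using Plus.prems(1,2) t' by simp_all
  have "shape a @ (shape b @ u) = shape c @ (shape d @ u')"
    "letters a @ (letters b @ l) = letters c @ (letters d @ l')"
    using Plus.prems(3,4) t' by simp_all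
  from Plus.IH(1)[OF ut(1,3) this] have 1: "a = c" "shape b @ u = shape d @ u'" "letters b @ l = letters d @ l'"
    by blast+
  from Plus.IH(2)[OF ut(2,4) 1(2,3)] 1(1) show ?case unfolding t' by blast
next
  case (Sym x)
  then show ?case by (cases t') auto
next
  case (Times a b)
  from Times.prems(1) show ?case by simp
next
  case (Star a)
  from Star.prems(1) show ?case by simp
next
  case Eps
  from Eps.prems(1) show ?case by simp
qed

lemma union_tree_counts:
  assumes "union_tree t"
  shows "length (shape t) = 2 * length (letters t) - 1" "rsize t = 2 * length (letters t) - 1"
    "letters t \<noteq> []" "\<not> nullable t" "nfirst t = length (letters t)" "nlast t = length (letters t)"
    "nfollow t = 0" "nloop t = length (letters t) * length (letters t)"
proof -
  have "length (shape t) + 1 = 2 * length (letters t) \<and> rsize t + 1 = 2 * length (letters t) \<and>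
    letters t \<noteq> [] \<and> \<not> nullable t \<and> nfirst t = length (letters t) \<and> nlast t = length (letters t) \<and>
    nfollow t = 0 \<and> nloop t = length (letters t) * length (letters t)"
    using assms by (induction t) (auto simp: algebra_simps)
  then show "length (shape t) = 2 * length (letters t) - 1" "rsize t = 2 * length (letters t) - 1"
    "letters t \<noteq> []" "\<not> nullable t" "nfirst t = length (letters t)" "nlast t = length (letters t)"
    "nfollow t = 0" "nloop t = length (letters t) * length (letters t)"
    by auto
qed

lemma sigma_stars_counts:
  assumes "\<beta> \<in> sigma_stars k"
  shows "rsize \<beta> = 2 * k" "nullable \<beta>" "nfirst \<beta> = k" "nlast \<beta> = k" "nfollow \<beta> = k * k" "nloop \<beta> = k * k"
proof -
  obtain t where t: "\<beta> = Star t" "union_tree t" "distinct (letters t)" "set (letters t) = {..<k}"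
    using assms by (auto simp: sigma_stars_def sigma_star_def)
  have len: "length (letters t) = k" using distinct_card[OF t(3)] t(4) by simp
  moreover have "length (letters t) > 0" using union_tree_counts(3)[OF t(2)] by simp
  ultimately show "rsize \<beta> = 2 * k" "nullable \<beta>" "nfirst \<beta> = k" "nlast \<beta> = k" "nfollow \<beta> = k * k" "nloop \<beta> = k * k"
    using union_tree_counts[OF t(2)] t(1) by auto
qed

text \<open>A tree with k leaves has 2k - 1 nodes, hence a shape among 2^(2k-1) words, and its
  leaves spell a permutation of the alphabet.\<close>

lemma card_sigma_stars: "finite (sigma_stars k)" "card (sigma_stars k) \<le> 2 ^ (2 * k - 1) * fact k"
proof -
  let ?D = "{xs :: bool list. set xs \<subseteq> UNIV \<and> length xs = 2 * k - 1} \<times> permutations_of_set {..<k}"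
  let ?T = "{t. union_tree t \<and> distinct (letters t) \<and> set (letters t) = {..<k}}"
  have fin: "finite ?D" using finite_lists_length_eq[of "UNIV :: bool set"] by simp
  have inj: "inj_on (\<lambda>t. (shape t, letters t)) ?T"
    using shape_letters_inject[where u = "[]" and u' = "[]" and l = "[]" and l' = "[]"]
    by (auto intro!: inj_onI)
  have sub: "(\<lambda>t. (shape t, letters t)) ` ?T \<subseteq> ?D"
  proof (clarsimp, intro conjI)
    fix t assume t: "union_tree t" "distinct (letters t)" "set (letters t) = {..<k}"
    then show "length (shape t) = 2 * k - Suc 0"
      using union_tree_counts(1)[OF t(1)] distinct_card[OF t(2)] by simp
    show "letters t \<in> permutations_of_set {..<k}" using t by (simp add: permutations_of_set_def)
  qed
  have T: "finite ?T" "card ?T \<le> card ?D"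
    using inj_on_finite[OF inj sub fin] card_inj_on_le[OF inj sub fin] by auto
  have S: "sigma_stars k = Star ` ?T" by (auto simp: sigma_stars_def sigma_star_def)
  have "card ?D = 2 ^ (2 * k - 1) * fact k"
    using card_lists_length_eq[of "UNIV :: bool set" "2 * k - 1"]
    by (simp add: card_cartesian_product)
  then show "card (sigma_stars k) \<le> 2 ^ (2 * k - 1) * fact k"
    unfolding S using T card_image_le[of ?T Star] by linarith
  show "finite (sigma_stars k)" unfolding S using T by simp
qed

lemma gf_sigma_stars:
  "gf (sigma_stars k) (\<lambda>_. 1) = fps_const (real (card (sigma_stars k))) * fps_X ^ (2 * k)"
proof (rule fps_ext)
  fix n
  have "level (sigma_stars k) n = (if n = 2 * k then sigma_stars k else {})"
    using sigma_stars_counts(1) by (auto simp: level_def)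
  then show "fps_nth (gf (sigma_stars k) (\<lambda>_. 1)) n
      = fps_nth (fps_const (real (card (sigma_stars k))) * fps_X ^ (2 * k)) n"
    by (simp add: gf_def)
qed

section \<open>Functional equations of the series\<close>

definition gR where "gR k = gf (RE_na k) (\<lambda>_. 1)"
definition gS where "gS k = gf (sigma_stars k) (\<lambda>_. 1)"
definition gN where "gN k = gf (RE_na k) (\<lambda>\<beta>. of_bool (\<not> nullable \<beta>))"
definition gF where "gF k = gf (RE_na k) (\<lambda>\<beta>. real (nfirst \<beta>))"
definition gL where "gL k = gf (RE_na k) (\<lambda>\<beta>. real (nlast \<beta>))"
definition gE where "gE k = gf (RE_na k) (\<lambda>\<beta>. real (nfollow \<beta>))"
definition gG where "gG k = gf (RE_na k) (\<lambda>\<beta>. real (nloop \<beta>))"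

lemma gf_plus_class: "gf (RE_na k - sigma_stars k) u = gf (RE_na k) u - gf (sigma_stars k) u"
  by (rule gf_Diff_set[OF sigma_stars_RE_na RE_na_over])

lemma plus_class_over: "RE_na k - sigma_stars k \<subseteq> over k"
  using RE_na_over by blast

lemma gf_sigma_stars_const:
  "(\<And>\<beta>. \<beta> \<in> sigma_stars k \<Longrightarrow> u \<beta> = c) \<Longrightarrow> gf (sigma_stars k) u = fps_const c * gS k"
  unfolding gS_def by (subst gf_const[symmetric]) (rule gf_cong)

text \<open>All these weights are constant on Sigma-star expressions. Since the latter are nullable,
  their removal leaves N unchanged.\<close>

lemma gf_plus_class_eqs:
  "gf (RE_na k - sigma_stars k) (\<lambda>_. 1) = gR k - gS k"
  "gf (RE_na k - sigma_stars k) (\<lambda>\<beta>. of_bool (\<not> nullable \<beta>)) = gN k"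
  "gf (RE_na k - sigma_stars k) (\<lambda>\<beta>. real (nfirst \<beta>)) = gF k - fps_const (real k) * gS k"
  "gf (RE_na k - sigma_stars k) (\<lambda>\<beta>. real (nlast \<beta>)) = gL k - fps_const (real k) * gS k"
  "gf (RE_na k - sigma_stars k) (\<lambda>\<beta>. real (nfollow \<beta>)) = gE k - fps_const ((real k)\<^sup>2) * gS k"
  "gf (RE_na k - sigma_stars k) (\<lambda>\<beta>. real (nloop \<beta>)) = gG k - fps_const ((real k)\<^sup>2) * gS k"
  unfolding gf_plus_class gR_def gN_def gF_def gL_def gE_def gG_def
  using gf_sigma_stars_const[of k "\<lambda>_. 1" 1]
    gf_sigma_stars_const[of k "\<lambda>\<beta>. of_bool (\<not> nullable \<beta>)" 0]
    gf_sigma_stars_const[of k "\<lambda>\<beta>. real (nfirst \<beta>)" "real k"]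
    gf_sigma_stars_const[of k "\<lambda>\<beta>. real (nlast \<beta>)" "real k"]
    gf_sigma_stars_const[of k "\<lambda>\<beta>. real (nfollow \<beta>)" "(real k)\<^sup>2"]
    gf_sigma_stars_const[of k "\<lambda>\<beta>. real (nloop \<beta>)" "(real k)\<^sup>2"]
  by (simp_all add: sigma_stars_counts power2_eq_square)

lemmas gf_eqs = gR_def[symmetric] gN_def[symmetric] gF_def[symmetric] gL_def[symmetric]
  gE_def[symmetric] gG_def[symmetric]

lemmas gf2_expand = gf2_add gf2_diff gf2_prod[OF RE_na_over] gf2_prod[OF plus_class_over]

lemma gR_eq: "gR k = fps_X * (fps_const (real k + 1) + (gR k - gS k) * (gR k - gS k) + gR k * gR k + gR k)"
proof -
  have "gf2 (RE_na k - sigma_stars k) (\<lambda>a b. 1) = (gR k - gS k) * (gR k - gS k)"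
    using gf2_prod[OF plus_class_over, of k "\<lambda>_. 1" "\<lambda>_. 1"] by (simp add: gf_plus_class_eqs)
  moreover have "gf2 (RE_na k) (\<lambda>a b. 1) = gR k * gR k"
    using gf2_prod[OF RE_na_over, of k "\<lambda>_. 1" "\<lambda>_. 1"] by (simp add: gR_def)
  moreover have "gf (RE_na k) (\<lambda>a. 1) = gR k" by (simp add: gR_def)
  moreover have "1 + (\<Sum>a<k. 1) = real k + 1" by simp
  ultimately show ?thesis
    by (intro trans[OF gR_def gf_RE_na_eqI])
qed

text \<open>A union is non-nullable iff both operands are, a concatenation iff at least one is. By
  inclusion-exclusion the two N^2 terms cancel and the equation is linear in N.\<close>

lemma gN_eq: "gN k = fps_X * (fps_const (real k) + 2 * gN k * gR k)"
proof -
  let ?n = "\<lambda>\<beta>. of_bool (\<not> nullable \<beta>) :: real"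
  have "gf2 (RE_na k - sigma_stars k) (\<lambda>a b. ?n (Plus a b)) = gf2 (RE_na k - sigma_stars k) (\<lambda>a b. ?n a * ?n b)"
    by (rule gf2_cong) auto
  also have "\<dots> = gN k * gN k" by (simp only: gf2_expand gf_plus_class_eqs)
  finally have 1: "gf2 (RE_na k - sigma_stars k) (\<lambda>a b. ?n (Plus a b)) = gN k * gN k" .
  have "gf2 (RE_na k) (\<lambda>a b. ?n (Times a b)) = gf2 (RE_na k) (\<lambda>a b. ?n a * 1 + 1 * ?n b - ?n a * ?n b)"
    by (rule gf2_cong) auto
  also have "\<dots> = gN k * gR k + gR k * gN k - gN k * gN k" by (simp only: gf2_expand gf_eqs)
  finally have 2: "gf2 (RE_na k) (\<lambda>a b. ?n (Times a b)) = gN k * gR k + gR k * gN k - gN k * gN k" .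
  have 3: "gf (RE_na k) (\<lambda>a. ?n (Star a)) = 0" using gf_const[of "RE_na k" 0] by simp
  have 4: "?n Eps + (\<Sum>a<k. ?n (Sym a)) = real k" by simp
  show ?thesis
    by (rule trans[OF trans[OF gN_def gf_RE_na_eqI[OF 1 2 3 4]]]) (simp add: algebra_simps)
qed

lemma gF_eq: "gF k = fps_X * (fps_const (real k) + 2 * (gF k - fps_const (real k) * gS k) * (gR k - gS k)
    + gF k * gR k + (gR k - gN k) * gF k + gF k)"
proof -
  let ?n = "\<lambda>\<beta>. of_bool (\<not> nullable \<beta>) :: real" and ?f = "\<lambda>\<beta>. real (nfirst \<beta>)"
  let ?P = "RE_na k - sigma_stars k"
  have "gf2 ?P (\<lambda>a b. ?f (Plus a b)) = gf2 ?P (\<lambda>a b. ?f a * 1 + 1 * ?f b)"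
    by (rule gf2_cong) auto
  also have "\<dots> = (gF k - fps_const (real k) * gS k) * (gR k - gS k) + (gR k - gS k) * (gF k - fps_const (real k) * gS k)"
    by (simp only: gf2_expand gf_plus_class_eqs)
  finally have 1: "gf2 ?P (\<lambda>a b. ?f (Plus a b)) = \<dots>" .
  have "gf2 (RE_na k) (\<lambda>a b. ?f (Times a b)) = gf2 (RE_na k) (\<lambda>a b. ?f a * 1 + 1 * ?f b - ?n a * ?f b)"
    by (rule gf2_cong) auto
  also have "\<dots> = gF k * gR k + gR k * gF k - gN k * gF k" by (simp only: gf2_expand gf_eqs)
  finally have 2: "gf2 (RE_na k) (\<lambda>a b. ?f (Times a b)) = \<dots>" .
  have 3: "gf (RE_na k) (\<lambda>a. ?f (Star a)) = gF k" by (simp add: gF_def)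
  have 4: "?f Eps + (\<Sum>a<k. ?f (Sym a)) = real k" by simp
  show ?thesis
    by (rule trans[OF trans[OF gF_def gf_RE_na_eqI[OF 1 2 3 4]]]) (simp add: algebra_simps)
qed

lemma gL_eq: "gL k = fps_X * (fps_const (real k) + 2 * (gL k - fps_const (real k) * gS k) * (gR k - gS k)
    + gL k * gR k + (gR k - gN k) * gL k + gL k)"
proof -
  let ?n = "\<lambda>\<beta>. of_bool (\<not> nullable \<beta>) :: real" and ?l = "\<lambda>\<beta>. real (nlast \<beta>)"
  let ?P = "RE_na k - sigma_stars k"
  have "gf2 ?P (\<lambda>a b. ?l (Plus a b)) = gf2 ?P (\<lambda>a b. ?l a * 1 + 1 * ?l b)"
    by (rule gf2_cong) auto
  also have "\<dots> = (gL k - fps_const (real k) * gS k) * (gR k - gS k) + (gR k - gS k) * (gL k - fps_const (real k) * gS k)"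
    by (simp only: gf2_expand gf_plus_class_eqs)
  finally have 1: "gf2 ?P (\<lambda>a b. ?l (Plus a b)) = \<dots>" .
  have "gf2 (RE_na k) (\<lambda>a b. ?l (Times a b)) = gf2 (RE_na k) (\<lambda>a b. ?l a * 1 - ?l a * ?n b + 1 * ?l b)"
    by (rule gf2_cong) auto
  also have "\<dots> = gL k * gR k - gL k * gN k + gR k * gL k" by (simp only: gf2_expand gf_eqs)
  finally have 2: "gf2 (RE_na k) (\<lambda>a b. ?l (Times a b)) = \<dots>" .
  have 3: "gf (RE_na k) (\<lambda>a. ?l (Star a)) = gL k" by (simp add: gL_def)
  have 4: "?l Eps + (\<Sum>a<k. ?l (Sym a)) = real k" by simp
  show ?thesis
    by (rule trans[OF trans[OF gL_def gf_RE_na_eqI[OF 1 2 3 4]]]) (simp add: algebra_simps)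
qed

text \<open>Both series solve the same linear equation, whose factor D has constant term 1 and can
  be cancelled. Products of Last and First thereby become F^2.\<close>

lemma gL_eq_gF: "gL k = gF k"
proof -
  define D where "D = 1 - fps_X * (2 * (gR k - gS k) + gR k + (gR k - gN k) + 1)"
  define C where "C = fps_X * (fps_const (real k) - 2 * fps_const (real k) * gS k * (gR k - gS k))"
  have "gF k * D = C"
  proof -
    have "gF k * D = gF k - fps_X * (gF k * (2 * (gR k - gS k) + gR k + (gR k - gN k) + 1))"
      by (simp add: D_def algebra_simps)
    also have "\<dots> = C" by (subst (1) gF_eq) (simp add: C_def algebra_simps)
    finally show ?thesis .
  qed
  moreover have "gL k * D = C"
  proof -
    have "gL k * D = gL k - fps_X * (gL k * (2 * (gR k - gS k) + gR k + (gR k - gN k) + 1))"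
      by (simp add: D_def algebra_simps)
    also have "\<dots> = C" by (subst (1) gL_eq) (simp add: C_def algebra_simps)
    finally show ?thesis .
  qed
  moreover have "fps_nth D 0 = 1" by (simp add: D_def)
  then have "D \<noteq> 0" by auto
  ultimately show ?thesis using mult_right_cancel[of D "gL k" "gF k"] by simp
qed

lemma gE_eq: "gE k = fps_X * (2 * (gE k - fps_const ((real k)\<^sup>2) * gS k) * (gR k - gS k)
    + 2 * gE k * gR k + gF k * gF k + gG k)"
proof -
  let ?f = "\<lambda>\<beta>. real (nfirst \<beta>)" and ?l = "\<lambda>\<beta>. real (nlast \<beta>)" and ?e = "\<lambda>\<beta>. real (nfollow \<beta>)"
  let ?P = "RE_na k - sigma_stars k"
  have "gf2 ?P (\<lambda>a b. ?e (Plus a b)) = gf2 ?P (\<lambda>a b. ?e a * 1 + 1 * ?e b)"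
    by (rule gf2_cong) auto
  also have "\<dots> = (gE k - fps_const ((real k)\<^sup>2) * gS k) * (gR k - gS k) + (gR k - gS k) * (gE k - fps_const ((real k)\<^sup>2) * gS k)"
    by (simp only: gf2_expand gf_plus_class_eqs)
  finally have 1: "gf2 ?P (\<lambda>a b. ?e (Plus a b)) = \<dots>" .
  have "gf2 (RE_na k) (\<lambda>a b. ?e (Times a b)) = gf2 (RE_na k) (\<lambda>a b. ?e a * 1 + 1 * ?e b + ?l a * ?f b)"
    by (rule gf2_cong) auto
  also have "\<dots> = gE k * gR k + gR k * gE k + gF k * gF k"
    by (simp only: gf2_expand gf_eqs gL_eq_gF)
  finally have 2: "gf2 (RE_na k) (\<lambda>a b. ?e (Times a b)) = \<dots>" .
  have 3: "gf (RE_na k) (\<lambda>a. ?e (Star a)) = gG k" by (simp add: gG_def)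
  have 4: "?e Eps + (\<Sum>a<k. ?e (Sym a)) = 0" by simp
  show ?thesis
    by (rule trans[OF trans[OF gE_def gf_RE_na_eqI[OF 1 2 3 4]]]) (simp add: algebra_simps)
qed

lemma gG_eq: "gG k = fps_X * (fps_const (real k) + 2 * (gG k - fps_const ((real k)\<^sup>2) * gS k) * (gR k - gS k)
    + 2 * (gF k - fps_const (real k) * gS k) * (gF k - fps_const (real k) * gS k)
    + 2 * gG k * (gR k - gN k) + 2 * gE k * gN k + 2 * gF k * gF k + gG k)"
proof -
  let ?n = "\<lambda>\<beta>. of_bool (\<not> nullable \<beta>) :: real"
  let ?f = "\<lambda>\<beta>. real (nfirst \<beta>)" and ?l = "\<lambda>\<beta>. real (nlast \<beta>)"
  let ?e = "\<lambda>\<beta>. real (nfollow \<beta>)" and ?g = "\<lambda>\<beta>. real (nloop \<beta>)"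
  let ?P = "RE_na k - sigma_stars k"
  let ?F = "gF k - fps_const (real k) * gS k" and ?G = "gG k - fps_const ((real k)\<^sup>2) * gS k"
  have "gf2 ?P (\<lambda>a b. ?g (Plus a b)) = gf2 ?P (\<lambda>a b. ?g a * 1 + 1 * ?g b + ?l a * ?f b + ?f a * ?l b)"
    by (rule gf2_cong) auto
  also have "\<dots> = ?G * (gR k - gS k) + (gR k - gS k) * ?G + ?F * ?F + ?F * ?F"
    by (simp only: gf2_expand gf_plus_class_eqs gL_eq_gF)
  finally have 1: "gf2 ?P (\<lambda>a b. ?g (Plus a b)) = \<dots>" .
  \<comment> \<open>With the indicator n of non-nullability, g(a) - g(a) n(b) + e(a) n(b) selects
    g(a) or e(a) as in the definition of \<open>nloop\<close>.\<close>
  have "gf2 (RE_na k) (\<lambda>a b. ?g (Times a b)) = gf2 (RE_na k) (\<lambda>a b. ?g a * 1 - ?g a * ?n b + ?e a * ?n b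
      + (1 * ?g b - ?n a * ?g b + ?n a * ?e b) + ?l a * ?f b + ?f a * ?l b)"
    by (rule gf2_cong) auto
  also have "\<dots> = gG k * gR k - gG k * gN k + gE k * gN k + (gR k * gG k - gN k * gG k + gN k * gE k)
      + gF k * gF k + gF k * gF k"
    by (simp only: gf2_expand gf_eqs gL_eq_gF)
  finally have 2: "gf2 (RE_na k) (\<lambda>a b. ?g (Times a b)) = \<dots>" .
  have 3: "gf (RE_na k) (\<lambda>a. ?g (Star a)) = gG k" by (simp add: gG_def)
  have 4: "?g Eps + (\<Sum>a<k. ?g (Sym a)) = real k" by simp
  show ?thesis
    by (rule trans[OF trans[OF gG_def gf_RE_na_eqI[OF 1 2 3 4]]]) (simp add: algebra_simps)
qed

lemma r_count_eq: "real (r_count k n) = fps_nth (gR k) n"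
  by (simp add: r_count_def gR_def gf_def level_def)

lemma t_count_eq: "real (t_count k n) = fps_nth (gF k + gE k) n"
  by (simp add: t_count_def gF_def gE_def gf_def level_def glushkov_transitions_eq sum.distrib)

section \<open>The dominant singularity and the limit constant\<close>

text \<open>The polynomial \<open>\<Delta> = (1 - z + 2zS)\<^sup>2 - 8z\<^sup>2(k + 1 + S\<^sup>2)\<close> with \<open>S = c z\<^sup>2\<^sup>k\<close>.\<close>

definition disc_poly :: "nat \<Rightarrow> real \<Rightarrow> real poly" where
  "disc_poly k c = ([:1, -1:] + monom (2 * c) (2 * k + 1))\<^sup>2
     - [:0, 0, 8:] * ([:real k + 1:] + monom (c\<^sup>2) (4 * k))"

lemma poly_disc_poly:
  "poly (disc_poly k c) x = (1 - x + 2 * x * (c * x ^ (2 * k)))\<^sup>2 - 8 * x\<^sup>2 * (real k + 1 + (c * x ^ (2 * k))\<^sup>2)"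
proof -
  have "x ^ (4 * k) = (x ^ (2 * k))\<^sup>2" by (simp add: power_mult[symmetric] mult.commute)
  then show ?thesis
    by (simp add: disc_poly_def poly_monom power2_eq_square power_mult_distrib algebra_simps)
qed

text \<open>Written through s = S(x) with the minus sign in front, the derivative is visibly
  negative when 0 < x < 1, s >= 0 and 2 (2k + 1) s < 1.\<close>

lemma poly_pderiv_disc_poly:
  assumes s: "s = c * x ^ (2 * k)"
  shows "poly (pderiv (disc_poly k c)) x = - (2 * (1 - x + 2 * x * s) * (1 - 2 * (2 * real k + 1) * s)
     + 16 * x * (real k + 1 + s\<^sup>2) + 32 * x * real k * s\<^sup>2)"
\<comment> \<open>The case k = 0 is separate because the exponent \<open>4 * k - 1\<close> arising
  otherwise is a truncated difference.\<close>
proof (cases k)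
  case 0
  have "pderiv (disc_poly k c) = pderiv (([:1, -1:] + [:0, 2 * c:])\<^sup>2 - [:0, 0, 8:] * ([:1:] + [:c\<^sup>2:]))"
    by (simp add: disc_poly_def 0 monom_altdef)
  then show ?thesis using s 0
    by (simp add: pderiv_pCons pderiv_mult power2_eq_square algebra_simps)
next
  case (Suc j)
  have x4: "x ^ (4 * k) = (x ^ (2 * k))\<^sup>2" by (simp add: power_mult[symmetric] mult.commute)
  have d1: "pderiv ([:1, -1:] + monom (2 * c) (2 * k + 1)) = [:-1:] + monom (2 * c * (2 * real k + 1)) (2 * k)"
    by (simp add: pderiv_add pderiv_monom pderiv_pCons algebra_simps)
  have d2: "pderiv ([:real k + 1:] + monom (c\<^sup>2) (4 * k)) = monom (4 * real k * c\<^sup>2) (4 * k - 1)"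
    by (simp add: pderiv_add pderiv_monom pderiv_pCons algebra_simps)
  have x4'': "x ^ (k * 2) * x ^ (k * 2) = x ^ (k * 4)"
    by (rule trans[OF power_add[symmetric]]) (simp add: mult.commute)
  have x4': "x * x ^ (4 * k - 1) = (x ^ (2 * k))\<^sup>2"
  proof -
    have "x * x ^ (4 * k - 1) = x ^ Suc (4 * k - 1)" by simp
    also have "Suc (4 * k - 1) = 4 * k" using Suc by simp
    finally show ?thesis by (simp only: x4)
  qed
  have "poly (pderiv (disc_poly k c)) x =
      2 * (1 - x + 2 * x * s) * (-1 + 2 * (2 * real k + 1) * s)
      - (16 * x * (real k + 1 + s\<^sup>2) + 8 * x * (x * (4 * real k * c\<^sup>2 * x ^ (4 * k - 1))))"
    unfolding disc_poly_def power2_eq_square[of "[:1, -1:] + monom (2 * c) (2 * k + 1)"] pderiv_diff pderiv_mult d1 d2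
    by (simp add: poly_monom pderiv_pCons s x4'' power_mult_distrib power2_eq_square algebra_simps)
  also have "x * (4 * real k * c\<^sup>2 * x ^ (4 * k - 1)) = 4 * real k * c\<^sup>2 * (x * x ^ (4 * k - 1))" by simp
  also have "\<dots> = 4 * real k * s\<^sup>2" unfolding x4' by (simp add: s power_mult_distrib)
  finally show ?thesis by (simp add: algebra_simps)
qed

section \<open>Location of the least positive root\<close>

lemma fact_Suc_le_power: "(fact (Suc m) :: real) \<le> (real m + 2) ^ m"
proof (induction m)
  case (Suc m)
  have "(fact (Suc (Suc m)) :: real) = (real m + 2) * fact (Suc m)"
    by (simp only: fact_Suc[of "Suc m"]) simp
  also have "\<dots> \<le> (real m + 2) * (real m + 2) ^ m" using Suc by (intro mult_left_mono) auto
  also have "\<dots> = (real m + 2) ^ Suc m" by simp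
  also have "\<dots> \<le> (real (Suc m) + 2) ^ Suc m" by (intro power_mono) auto
  finally show ?case .
qed simp

text \<open>The point is the solution of 8 x^2 (k + 1) = 1. Since k! <= (k + 1)^(k - 1), the spare
  power of k + 1 absorbs 2k + 1 <= 2 (k + 1), and 4^k / 8^k remains.\<close>

lemma sigma_star_weight_bound:
  assumes k: "k \<ge> 1" and c: "c \<le> 2 ^ (2 * k - 1) * fact k"
  shows "(2 * real k + 1) * (c * (1 / sqrt (8 * (real k + 1))) ^ (2 * k)) \<le> (1 / 2) ^ k"
proof -
  obtain j where j: "k = Suc j" using k by (cases k) auto
  have z: "(1 / sqrt (8 * (real k + 1))) ^ (2 * k) = 1 / (8 ^ k * (real k + 1) ^ k)"
  proof -
    have "(1 / sqrt (8 * (real k + 1))) ^ (2 * k) = (1 / (8 * (real k + 1))) ^ k"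
      unfolding power_mult by (simp add: power_divide)
    then show ?thesis by (simp only: power_divide power_mult_distrib power_one)
  qed
  have "(2 * real k + 1) * c \<le> (2 * real k + 1) * (2 ^ (2 * k - 1) * fact k)"
    using c by (intro mult_left_mono) auto
  also have "\<dots> \<le> (2 * (real k + 1)) * (2 ^ (2 * k - 1) * (real k + 1) ^ j)"
    using fact_Suc_le_power[of j] j by (intro mult_mono) (auto simp: add.commute)
  also have "\<dots> = 2 ^ (2 * k) * (real k + 1) ^ k" using j by simp
  also have "(2::real) ^ (2 * k) = 4 ^ k" unfolding power_mult by simp
  finally have "(2 * real k + 1) * c \<le> 4 ^ k * (real k + 1) ^ k" .
  then have "(2 * real k + 1) * c / (8 ^ k * (real k + 1) ^ k) \<le> 4 ^ k * (real k + 1) ^ k / (8 ^ k * (real k + 1) ^ k)"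
    by (intro divide_right_mono) auto
  moreover have "(8 :: real) ^ k = 2 ^ k * 4 ^ k" by (simp flip: power_mult_distrib)
  then have "4 ^ k * (real k + 1) ^ k / (8 ^ k * (real k + 1) ^ k) = (1 / 2) ^ k"
    by (simp add: power_one_over)
  ultimately show ?thesis unfolding z by simp
qed

text \<open>At z with 8 z^2 (k + 1) = 1 the polynomial is negative, at 0 it is positive, and its
  derivative is negative on (0, z] because S is tiny there. This yields a root r < z, and the mean
  value theorem gives positivity to its left.\<close>

lemma disc_poly_root:
  assumes k: "k \<ge> 2" and c0: "c \<ge> 0" and c: "c \<le> 2 ^ (2 * k - 1) * fact k"
  obtains r where "r > 0" "r\<^sup>2 \<le> 1 / (8 * (real k + 1))" "poly (disc_poly k c) r = 0"
    "\<And>x. 0 \<le> x \<Longrightarrow> x < r \<Longrightarrow> poly (disc_poly k c) x > 0"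
    "poly (pderiv (disc_poly k c)) r < 0"
    "(2 * real k + 1) * (c * r ^ (2 * k)) \<le> (1 / 2) ^ k" "c * r ^ (2 * k) \<le> r / 2"
proof -
  define z where "z = 1 / sqrt (8 * (real k + 1))"
  have z: "z > 0" by (simp add: z_def)
  have z2: "z\<^sup>2 = 1 / (8 * (real k + 1))" by (simp add: z_def power_divide)
  have "z\<^sup>2 < 1\<^sup>2" unfolding z2 by (simp add: field_simps)
  then have z1: "z < 1" using power2_less_imp_less[of z 1] by simp
  have sz: "(2 * real k + 1) * (c * z ^ (2 * k)) \<le> (1 / 2) ^ k"
    using sigma_star_weight_bound[OF _ c] k by (simp add: z_def)
  have sx: "(2 * real k + 1) * (c * x ^ (2 * k)) \<le> (1 / 2) ^ k" if "0 \<le> x" "x \<le> z" for x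
  proof -
    have "(2 * real k + 1) * (c * x ^ (2 * k)) \<le> (2 * real k + 1) * (c * z ^ (2 * k))"
      using that c0 by (intro mult_left_mono power_mono) auto
    then show ?thesis using sz by linarith
  qed
  have half: "(1 / 2 :: real) ^ k \<le> 1 / 4"
    using power_decreasing[OF k, of "1/2 :: real"] by (simp add: power2_eq_square)
  have neg: "poly (pderiv (disc_poly k c)) x < 0" if x: "0 < x" "x \<le> z" for x
  proof -
    define s where "s = c * x ^ (2 * k)"
    have "s \<ge> 0" using c0 x by (simp add: s_def)
    have "(2 * real k + 1) * s \<le> 1 / 4" using sx[of x] x half by (simp add: s_def)
    moreover have "2 * (2 * real k + 1) * s = 2 * ((2 * real k + 1) * s)" by simp
    ultimately have "1 - 2 * (2 * real k + 1) * s > 0" by linarith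
    moreover have "1 - x + 2 * x * s > 0" using x z1 \<open>s \<ge> 0\<close> by (intro add_pos_nonneg) auto
    ultimately have "0 < 2 * (1 - x + 2 * x * s) * (1 - 2 * (2 * real k + 1) * s)"
      by (intro mult_pos_pos) auto
    moreover have "0 \<le> 16 * x * (real k + 1 + s\<^sup>2)" "0 \<le> 32 * x * real k * s\<^sup>2" using x by auto
    ultimately show ?thesis unfolding poly_pderiv_disc_poly[OF s_def] by linarith
  qed
  have "poly (disc_poly k c) z < 0"
  proof -
    define s where "s = c * z ^ (2 * k)"
    have s0: "s \<ge> 0" using c0 z by (simp add: s_def)
    have "(2 * real k + 1) * s \<le> 1 / 4" using sx[of z] z half by (simp add: s_def)
    moreover have "1 * s \<le> (2 * real k + 1) * s" using s0 by (intro mult_right_mono) auto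
    ultimately have s1: "s \<le> 1 / 4" by simp
    have "z * (2 * s) < z * 1" using s1 z by (intro mult_strict_left_mono) auto
    then have b: "1 - z + 2 * z * s < 1" "0 \<le> 1 - z + 2 * z * s" using z1 z s0 by auto
    have "(1 - z + 2 * z * s)\<^sup>2 < 1" using b by (simp add: abs_square_less_1)
    moreover have "8 * z\<^sup>2 * (real k + 1 + s\<^sup>2) = 1 + 8 * z\<^sup>2 * s\<^sup>2"
      unfolding z2 by (simp add: field_simps)
    moreover have "0 \<le> 8 * z\<^sup>2 * s\<^sup>2" by simp
    ultimately show ?thesis unfolding poly_disc_poly s_def[symmetric] by linarith
  qed
  moreover have "poly (disc_poly k c) 0 > 0" by (simp add: poly_disc_poly)
  ultimately obtain r where r: "0 < r" "r < z" "poly (disc_poly k c) r = 0"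
    using poly_IVT_neg[OF z] by blast
  show ?thesis
  proof (rule that)
    show "r > 0" "poly (disc_poly k c) r = 0" by fact+
    show "r\<^sup>2 \<le> 1 / (8 * (real k + 1))" unfolding z2[symmetric] using r by (intro power_mono) auto
    show "poly (pderiv (disc_poly k c)) r < 0" using neg r by simp
    show "(2 * real k + 1) * (c * r ^ (2 * k)) \<le> (1 / 2) ^ k" using sx r by simp
    show "poly (disc_poly k c) x > 0" if x: "0 \<le> x" "x < r" for x
    proof -
      obtain y where "x < y" "y < r" "poly (disc_poly k c) r - poly (disc_poly k c) x = (r - x) * poly (pderiv (disc_poly k c)) y"
        using poly_MVT[OF x(2)] by blast
      moreover have "(r - x) * poly (pderiv (disc_poly k c)) y < 0"
        using calculation x r by (intro mult_pos_neg neg) auto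
      ultimately show ?thesis using r by simp
    qed
    show "c * r ^ (2 * k) \<le> r / 2"
    proof -
      obtain j where j: "2 * k = Suc j" using k by (cases "2 * k") auto
      \<comment> \<open>One factor z is traded for 2 (2k + 1), as their product is at least 1; the
        bound on (2k + 1) c z^(2k) then gives c z^(2k-1) <= 1/2.\<close>
      have "sqrt (8 * (real k + 1)) \<le> 2 * (2 * real k + 1)"
      proof (rule real_le_lsqrt)
        have "8 * (x + 1) \<le> (2 * (2 * x + 1))\<^sup>2" if "x \<ge> 2" for x :: real
        proof -
          have "(2 * (2 * x + 1))\<^sup>2 = 16 * (x * x) + 16 * x + 4"
            by (simp add: power2_eq_square algebra_simps)
          moreover have "0 \<le> x * x" by simp
          ultimately have "8 * x + 8 \<le> (2 * (2 * x + 1))\<^sup>2" using that by linarith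
          then show ?thesis by simp
        qed
        then show "8 * (real k + 1) \<le> (2 * (2 * real k + 1))\<^sup>2" using k by simp
      qed simp
      then have z': "1 \<le> z * (2 * (2 * real k + 1))" by (simp add: z_def field_simps)
      have "c * z ^ j * 1 \<le> c * z ^ j * (z * (2 * (2 * real k + 1)))"
        using z' c0 z by (intro mult_left_mono) auto
      also have "\<dots> = 2 * ((2 * real k + 1) * (c * z ^ (2 * k)))" using j by (simp add: mult_ac)
      also have "\<dots> \<le> 1 / 2" using sz half by simp
      finally have "c * z ^ j \<le> 1 / 2" by simp
      moreover have "c * r ^ j \<le> c * z ^ j" using c0 r by (intro mult_left_mono power_mono) auto
      ultimately have "r * (c * r ^ j) \<le> r * (1 / 2)" using r by (intro mult_left_mono) auto
      then show ?thesis using j by (simp add: mult_ac)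
    qed
  qed
qed

section \<open>The limit constant: positivity and limit\<close>

text \<open>\<open>m\<close>, \<open>w\<close>, \<open>n\<close>, \<open>f\<close>, \<open>a\<close>, \<open>b\<close> are the values at \<open>r\<close> of \<open>zR\<close>, \<open>z(R - S)\<close>, \<open>N\<close>, \<open>F\<close>, \<open>A\<close>, \<open>B\<close>, where
  \<open>s = S(r)\<close>; \<open>h\<close> is the value of \<open>E X\<close>, and \<open>d = - \<Delta>'(r)\<close>.\<close>

definition lam_of :: "real \<Rightarrow> real \<Rightarrow> real \<Rightarrow> real" where
  "lam_of K r s = (let
     m = (1 - r + 2 * r * s) / 4;
     w = m - r * s;
     n = K * r / (1 - 2 * m);
     f = (K * r - 2 * K * s * w) / (r * n);
     a = r * f\<^sup>2 - 2 * K\<^sup>2 * s * w;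
     b = K * r - 2 * K\<^sup>2 * s * w + 2 * r * (f - K * s)\<^sup>2 + 2 * r * f\<^sup>2;
     h = (a * (2 * r * n) + r * b) / (r + 2 * r * n);
     d = 2 * (1 - r + 2 * r * s) * (1 - 2 * (2 * K + 1) * s) + 16 * r * (K + 1 + s\<^sup>2) + 32 * r * K * s\<^sup>2
   in 8 * h / d)"

text \<open>Positivity permits division by the constant in \<open>ratio_asymp\<close>. The key bound
  f >= 3 / (8r) makes r f^2 >= 9/16, while the only negative term in a and b has size at most
  1/8.\<close>

lemma lam_of_pos:
  assumes K: "K \<ge> 2" and r: "r > 0" "r\<^sup>2 \<le> 1 / (8 * (K + 1))" and s: "0 \<le> s" "s \<le> r / 2"
    and sK: "(2 * K + 1) * s \<le> 1 / 4" "K\<^sup>2 * s \<le> 1 / 4"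
  shows "lam_of K r s > 0"
proof -
  define m where "m = (1 - r + 2 * r * s) / 4"
  define w where "w = m - r * s"
  define n where "n = K * r / (1 - 2 * m)"
  define f where "f = (K * r - 2 * K * s * w) / (r * n)"
  define a where "a = r * f\<^sup>2 - 2 * K\<^sup>2 * s * w"
  define b where "b = K * r - 2 * K\<^sup>2 * s * w + 2 * r * (f - K * s)\<^sup>2 + 2 * r * f\<^sup>2"
  define d where "d = 2 * (1 - r + 2 * r * s) * (1 - 2 * (2 * K + 1) * s) + 16 * r * (K + 1 + s\<^sup>2) + 32 * r * K * s\<^sup>2"
  have lam: "lam_of K r s = 8 * ((a * (2 * r * n) + r * b) / (r + 2 * r * n)) / d"
    by (simp only: lam_of_def Let_def m_def w_def n_def f_def a_def b_def d_def)
  have "1 / (8 * (K + 1)) \<le> 1 / 16" using K by (simp add: field_simps)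
  then have "r\<^sup>2 \<le> (1/4)\<^sup>2" using r(2) by (simp add: power2_eq_square)
  then have r4: "r \<le> 1 / 4" by (rule power2_le_imp_le) simp
  have "1 * s \<le> (2 * K + 1) * s" using s K by (intro mult_right_mono) auto
  then have s4: "s \<le> 1 / 4" using sK by simp
  have rs: "0 \<le> r * s" "r * s \<le> r * (1/4)" using r s s4 by (auto intro!: mult_left_mono)
  have w_eq: "4 * w = 1 - r - 2 * (r * s)" by (simp add: w_def m_def field_simps)
  have "4 * (r * s) \<le> r" using rs by simp
  then have "0 \<le> w" using rs r4 r(1) w_eq by linarith
  moreover have "w \<le> 1 / 4" using rs r4 r(1) w_eq by linarith
  ultimately have w: "0 \<le> w" "w \<le> 1 / 4" by auto
  have "4 * m = 1 - r + 2 * (r * s)" by (simp add: m_def)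
  then have m: "1 / 2 \<le> 1 - 2 * m" using rs r(1) \<open>4 * (r * s) \<le> r\<close> by linarith
  have n: "n > 0" unfolding n_def using K r m by auto
  have f: "f \<ge> 3 / (8 * r)"
  proof -
    have "s * w \<le> (r / 2) * (1 / 4)" using s w r by (intro mult_mono) auto
    then have "K * (2 * (s * w)) \<le> K * (r / 4)" using K by (intro mult_left_mono) auto
    then have "K * r - 2 * K * s * w \<ge> 3 / 4 * (K * r)" by (simp add: algebra_simps)
    then have "f \<ge> 3 / 4 * (K * r) / (r * n)"
      unfolding f_def using r n by (intro divide_right_mono) auto
    also have "3 / 4 * (K * r) / (r * n) = 3 / 4 * (1 - 2 * m) / r"
      unfolding n_def using K r m by (simp add: field_simps)
    finally have "f \<ge> 3 / 4 * (1 - 2 * m) / r" .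
    moreover have "3 / 4 * (1 - 2 * m) / r \<ge> 3 / 4 * (1 / 2) / r"
      using m r by (intro divide_right_mono mult_left_mono) auto
    ultimately show ?thesis by simp
  qed
  have "r * f\<^sup>2 \<ge> r * (3 / (8 * r))\<^sup>2" using f r by (intro mult_left_mono power_mono) auto
  also have "r * (3 / (8 * r))\<^sup>2 = 9 / 64 / r" using r by (simp add: power2_eq_square field_simps)
  finally have "r * f\<^sup>2 \<ge> 9 / 64 / r" .
  moreover have "9 / 64 / r \<ge> 9 / 64 / (1 / 4)" using r r4 by (intro divide_left_mono) auto
  ultimately have rf: "r * f\<^sup>2 \<ge> 9 / 16" by simp
  have "(K\<^sup>2 * s) * w \<le> (1 / 4) * (1 / 4)" using sK s w by (intro mult_mono) auto
  then have kw: "2 * K\<^sup>2 * s * w \<le> 1 / 8" by simp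
  have a: "a > 0" unfolding a_def using rf kw by simp
  have "K * r > 0" "2 * r * (f - K * s)\<^sup>2 \<ge> 0" using K r by auto
  then have b: "b > 0" unfolding b_def using rf kw by linarith
  define t where "t = (2 * K + 1) * s"
  have t: "2 * (2 * K + 1) * s = 2 * t" by (simp add: t_def)
  have "t \<le> 1 / 4" using sK(1) by (simp only: t_def)
  then have "0 < 1 - 2 * (2 * K + 1) * s" unfolding t by simp
  moreover have "0 < 1 - r + 2 * r * s" using rs r4 by simp
  ultimately have "0 < (1 - r + 2 * r * s) * (1 - 2 * (2 * K + 1) * s)"
    by (rule mult_pos_pos[rotated])
  moreover have "0 \<le> 16 * r * (K + 1 + s\<^sup>2)" "0 \<le> 32 * r * K * s\<^sup>2" using r K by auto
  ultimately have d: "d > 0" unfolding d_def by linarith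
  show ?thesis unfolding lam using a b d n r by (intro divide_pos_pos mult_pos_pos add_pos_pos) auto
qed

text \<open>Here r, s, k s and k^2 s tend to 0, and the equation forces k r^2 -> 1/8. Multiplied by
  r, the quantities n, f, a, b, h, d of \<open>lam_of\<close> have the limits 1/4, 1/2, 1/4, 9/8,
  1/4, 2, and the common factor r cancels in 8h/d.\<close>

lemma lam_of_tendsto:
  fixes r s :: "nat \<Rightarrow> real"
  assumes r: "\<And>k. k \<ge> 2 \<Longrightarrow> 0 < r k \<and> (r k)\<^sup>2 \<le> 1 / (8 * (real k + 1))"
    and s: "\<And>k. k \<ge> 2 \<Longrightarrow> 0 \<le> s k \<and> (2 * real k + 1) * s k \<le> (1 / 2) ^ k"
    and eq: "\<And>k. k \<ge> 2 \<Longrightarrow> (1 - r k + 2 * r k * s k)\<^sup>2 = 8 * (r k)\<^sup>2 * (real k + 1 + (s k)\<^sup>2)"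
  shows "(\<lambda>k. lam_of (real k) (r k) (s k)) \<longlonglongrightarrow> 1"
proof -
  have ev2: "\<forall>\<^sub>F k in sequentially. k \<ge> (2::nat)" by (rule eventually_ge_at_top)
  have r2_lim: "(\<lambda>k. (r k)\<^sup>2) \<longlonglongrightarrow> 0"
  proof (rule tendsto_sandwich[of "\<lambda>_. 0" _ _ "\<lambda>k. 1 / (8 * (real k + 1))"])
    show "(\<lambda>k. 1 / (8 * (real k + 1))) \<longlonglongrightarrow> 0" by real_asymp
    show "\<forall>\<^sub>F k in sequentially. (r k)\<^sup>2 \<le> 1 / (8 * (real k + 1))" using ev2 by eventually_elim (use r in auto)
  qed auto
  then have "(\<lambda>k. sqrt ((r k)\<^sup>2)) \<longlonglongrightarrow> sqrt 0" by (rule tendsto_real_sqrt)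
  then have "(\<lambda>k. \<bar>r k\<bar>) \<longlonglongrightarrow> 0" by simp
  then have r_lim: "r \<longlonglongrightarrow> 0" by (simp add: tendsto_rabs_zero_iff)
  have bound: "s k \<le> (1 / 2) ^ k" "real k * s k \<le> (1/2) ^ k" "(real k)\<^sup>2 * s k \<le> real k * (1 / 2) ^ k" if "k \<ge> 2" for k
  proof -
    have "1 * s k \<le> (2 * real k + 1) * s k" "real k * s k \<le> (2 * real k + 1) * s k"
      by (rule mult_right_mono; use s[OF that] in simp)+
    then show "s k \<le> (1 / 2) ^ k" and ks: "real k * s k \<le> (1/2) ^ k" using s[OF that] by auto
    have "real k * (real k * s k) \<le> real k * (1/2) ^ k" using ks by (intro mult_left_mono) auto
    then show "(real k)\<^sup>2 * s k \<le> real k * (1 / 2) ^ k" by (simp add: power2_eq_square mult.assoc)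
  qed
  have s_lim: "s \<longlonglongrightarrow> 0"
  proof (rule tendsto_sandwich[of "\<lambda>_. 0" _ _ "\<lambda>k. (1 / 2) ^ k"])
    show "\<forall>\<^sub>F k in sequentially. 0 \<le> s k" using ev2 by eventually_elim (use s in auto)
    show "\<forall>\<^sub>F k in sequentially. s k \<le> (1 / 2) ^ k" using ev2 by eventually_elim (use bound in auto)
  qed (auto intro: LIMSEQ_power_zero)
  have ks_lim: "(\<lambda>k. real k * s k) \<longlonglongrightarrow> 0"
  proof (rule tendsto_sandwich[of "\<lambda>_. 0" _ _ "\<lambda>k. (1 / 2) ^ k"])
    show "\<forall>\<^sub>F k in sequentially. 0 \<le> real k * s k" using ev2 by eventually_elim (use s in auto)
    show "\<forall>\<^sub>F k in sequentially. real k * s k \<le> (1 / 2) ^ k" using ev2 by eventually_elim (use bound in auto)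
  qed (auto intro: LIMSEQ_power_zero)
  have kks_lim: "(\<lambda>k. (real k)\<^sup>2 * s k) \<longlonglongrightarrow> 0"
  proof (rule tendsto_sandwich[of "\<lambda>_. 0" _ _ "\<lambda>k. real k * (1 / 2) ^ k"])
    show "\<forall>\<^sub>F k in sequentially. 0 \<le> (real k)\<^sup>2 * s k" using ev2 by eventually_elim (use s in auto)
    show "\<forall>\<^sub>F k in sequentially. (real k)\<^sup>2 * s k \<le> real k * (1 / 2) ^ k" using ev2 by eventually_elim (use bound in auto)
    show "(\<lambda>k. real k * (1 / 2) ^ k) \<longlonglongrightarrow> 0" by real_asymp
  qed auto
  define q where "q = (\<lambda>k. real k * (r k)\<^sup>2)"
  have "(\<lambda>k. ((1 - r k + 2 * r k * s k)\<^sup>2 - 8 * (r k)\<^sup>2 * (1 + (s k)\<^sup>2)) / 8) \<longlonglongrightarrow> ((1 - 0 + 2 * 0 * 0)\<^sup>2 - 8 * 0 * (1 + 0\<^sup>2)) / 8"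
    by (intro tendsto_intros r_lim s_lim r2_lim) auto
  moreover have "\<forall>\<^sub>F k in sequentially. ((1 - r k + 2 * r k * s k)\<^sup>2 - 8 * (r k)\<^sup>2 * (1 + (s k)\<^sup>2)) / 8 = q k"
    using ev2
  proof eventually_elim
    case (elim k)
    show ?case unfolding eq[OF elim] q_def by (simp add: algebra_simps)
  qed
  ultimately have q_lim: "q \<longlonglongrightarrow> 1 / 8" by (auto intro: Lim_transform_eventually)
  define m where "m = (\<lambda>k. (1 - r k + 2 * r k * s k) / 4)"
  define w where "w = (\<lambda>k. m k - r k * s k)"
  define n where "n = (\<lambda>k. q k / (1 - 2 * m k))"
  define f where "f = (\<lambda>k. (q k - 2 * (real k * s k) * r k * w k) / n k)"
  define a where "a = (\<lambda>k. (f k)\<^sup>2 - 2 * ((real k)\<^sup>2 * s k) * r k * w k)"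
  define b where "b = (\<lambda>k. q k - 2 * ((real k)\<^sup>2 * s k) * r k * w k + 2 * (f k - r k * (real k * s k))\<^sup>2 + 2 * (f k)\<^sup>2)"
  define h where "h = (\<lambda>k. (a k * (2 * n k) + r k * b k) / (r k + 2 * n k))"
  define d where "d = (\<lambda>k. 2 * r k * (1 - r k + 2 * r k * s k) * (1 - 2 * (2 * (real k * s k) + s k))
     + 16 * (q k + (r k)\<^sup>2 * (1 + (s k)\<^sup>2)) + 32 * q k * (s k)\<^sup>2)"
  have m_lim: "m \<longlonglongrightarrow> (1 - 0 + 2 * 0 * 0) / 4" unfolding m_def by (intro tendsto_intros r_lim s_lim) auto
  have w_lim: "w \<longlonglongrightarrow> 1 / 4 - 0 * 0" unfolding w_def using m_lim by (intro tendsto_intros r_lim s_lim) auto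
  have "n \<longlonglongrightarrow> (1/8) / (1 - 2 * (1/4))" unfolding n_def using m_lim by (intro tendsto_intros q_lim) auto
  then have n_lim: "n \<longlonglongrightarrow> 1 / 4" by simp
  have "f \<longlonglongrightarrow> (1/8 - 2 * 0 * 0 * (1/4)) / (1/4)" unfolding f_def using w_lim
    by (intro tendsto_intros q_lim ks_lim r_lim n_lim) auto
  then have f_lim: "f \<longlonglongrightarrow> 1 / 2" by simp
  have "a \<longlonglongrightarrow> (1/2)\<^sup>2 - 2 * 0 * 0 * (1/4)" unfolding a_def using w_lim
    by (intro tendsto_intros f_lim kks_lim r_lim) auto
  then have a_lim: "a \<longlonglongrightarrow> 1 / 4" by (simp add: power2_eq_square)
  have b_lim: "b \<longlonglongrightarrow> 1/8 - 2 * 0 * 0 * (1/4) + 2 * (1/2 - 0 * 0)\<^sup>2 + 2 * (1/2)\<^sup>2" unfolding b_def using w_lim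
    by (intro tendsto_intros f_lim kks_lim r_lim q_lim ks_lim) auto
  have "h \<longlonglongrightarrow> (1/4 * (2 * (1/4)) + 0 * (1/8 - 2 * 0 * 0 * (1/4) + 2 * (1/2 - 0 * 0)\<^sup>2 + 2 * (1/2)\<^sup>2)) / (0 + 2 * (1/4))"
    unfolding h_def by (intro tendsto_intros a_lim b_lim n_lim r_lim) auto
  then have h_lim: "h \<longlonglongrightarrow> 1 / 4" by simp
  have "d \<longlonglongrightarrow> 2 * 0 * (1 - 0 + 2 * 0 * 0) * (1 - 2 * (2 * 0 + 0)) + 16 * (1/8 + 0 * (1 + 0\<^sup>2)) + 32 * (1/8) * 0\<^sup>2"
    unfolding d_def by (intro tendsto_intros r_lim s_lim ks_lim q_lim r2_lim)
  then have d_lim: "d \<longlonglongrightarrow> 2" by simp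
  have "(\<lambda>k. 8 * h k / d k) \<longlonglongrightarrow> 8 * (1/4) / 2" by (intro tendsto_intros h_lim d_lim) auto
  moreover have "\<forall>\<^sub>F k in sequentially. 8 * h k / d k = lam_of (real k) (r k) (s k)"
    using ev2
  proof eventually_elim
    case (elim k)
    have r0: "r k > 0" using r elim by auto
    \<comment> \<open>The primed quantities are those of \<open>lam_of\<close>; each unprimed one is
      r times its primed counterpart.\<close>
    define n' where "n' = real k * r k / (1 - 2 * m k)"
    define f' where "f' = (real k * r k - 2 * real k * s k * w k) / (r k * n')"
    define a' where "a' = r k * f'\<^sup>2 - 2 * (real k)\<^sup>2 * s k * w k"
    define b' where "b' = real k * r k - 2 * (real k)\<^sup>2 * s k * w k + 2 * r k * (f' - real k * s k)\<^sup>2 + 2 * r k * f'\<^sup>2"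
    define h' where "h' = (a' * (2 * r k * n') + r k * b') / (r k + 2 * r k * n')"
    define d' where "d' = 2 * (1 - r k + 2 * r k * s k) * (1 - 2 * (2 * real k + 1) * s k) + 16 * r k * (real k + 1 + (s k)\<^sup>2) + 32 * r k * real k * (s k)\<^sup>2"
    have lam: "lam_of (real k) (r k) (s k) = 8 * h' / d'"
      by (simp only: lam_of_def Let_def m_def w_def n'_def f'_def a'_def b'_def h'_def d'_def)
    have n: "n k = r k * n'" by (simp add: n_def n'_def q_def power2_eq_square)
    have f: "f k = r k * f'" by (simp add: f_def f'_def n q_def power2_eq_square algebra_simps)
    have a: "a k = r k * a'" by (simp add: a_def a'_def f power2_eq_square algebra_simps)
    have b: "b k = r k * b'" by (simp add: b_def b'_def f q_def power2_eq_square algebra_simps)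
    have h: "h k = r k * h'" by (simp add: h_def h'_def a b n algebra_simps)
    have d: "d k = r k * d'" by (simp add: d_def d'_def q_def power2_eq_square algebra_simps)
    show ?case unfolding lam h d using r0 by simp
  qed
  ultimately show ?thesis by (auto intro: Lim_transform_eventually)
qed

section \<open>Asymptotics of the ratio\<close>

text \<open>This is T = 1 - X, grouped so that its coefficients are visibly nonnegative.\<close>

definition gT :: "nat \<Rightarrow> real fps" where
  "gT k = fps_X * (2 * (gR k - gS k) + 2 * gR k + 1)"

lemma gf_nonneg_all:
  "gR k $ n \<ge> 0" "(gR k - gS k) $ n \<ge> 0" "(gR k - gN k) $ n \<ge> 0"
proof -
  show "gR k $ n \<ge> 0" unfolding gR_def by (rule gf_nonneg) simp
  show "(gR k - gS k) $ n \<ge> 0"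
    unfolding gf_plus_class_eqs(1)[symmetric] by (rule gf_nonneg) simp
  have "gR k - gN k = gf (RE_na k) (\<lambda>\<beta>. 1 - of_bool (\<not> nullable \<beta>))"
    by (simp only: gR_def gN_def gf_diff)
  then show "(gR k - gN k) $ n \<ge> 0" using gf_nonneg[of "RE_na k" "\<lambda>\<beta>. 1 - of_bool (\<not> nullable \<beta>)" n] by simp
qed

lemma fps_nth_X_mult_nonneg:
  "(\<And>m. A $ m \<ge> (0 :: real)) \<Longrightarrow> (fps_X * A) $ n \<ge> 0"
  by (cases n) auto

lemma two_times_nth: "(2 * A :: real fps) $ n = 2 * A $ n"
  by (metis fps_add_nth mult_2)

lemma gT_nonneg: "gT k $ n \<ge> 0"
  unfolding gT_def
proof (rule fps_nth_X_mult_nonneg)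
  fix m
  show "(2 * (gR k - gS k) + 2 * gR k + 1) $ m \<ge> 0"
    using gf_nonneg_all(1,2)[of k m] unfolding fps_add_nth two_times_nth by simp
qed

text \<open>Completing the square in the quadratic equation of R: the difference of the two sides is
  8z times that of \<open>gR_eq\<close>.\<close>

lemma gT_square:
  "(1 - gT k) * (1 - gT k) = fps_of_poly (disc_poly k (real (card (sigma_stars k))))"
proof -
  define c where "c = real (card (sigma_stars k))"
  have S: "gS k = fps_const c * fps_X ^ (2 * k)" by (simp add: gS_def gf_sigma_stars c_def)
  have m1: "fps_of_poly (monom (2 * c) (2 * k + 1)) = 2 * fps_X * gS k"
    by (simp add: fps_of_poly_monom S fps_const_mult[symmetric] numeral_fps_const del: fps_const_mult)
  have "fps_X ^ (4 * k) = (fps_X ^ (2 * k) * fps_X ^ (2 * k) :: real fps)"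
    unfolding power_add[symmetric] by simp
  then have m2: "fps_of_poly (monom (c\<^sup>2) (4 * k)) = gS k * gS k"
    by (simp add: fps_of_poly_monom S power2_eq_square fps_const_mult[symmetric] mult_ac del: fps_const_mult)
  have p1: "fps_of_poly [:1, -1 :: real:] = 1 - fps_X"
    by (simp add: fps_of_poly_pCons)
  have p2: "fps_of_poly [:0, 0, 8 :: real:] = 8 * fps_X * fps_X"
    by (simp add: fps_of_poly_pCons numeral_fps_const mult_ac)
  have p3: "fps_of_poly [:real k + 1:] = fps_const (real k + 1)" by (simp add: fps_of_poly_const)
  have D: "fps_of_poly (disc_poly k c) = (1 - fps_X + 2 * fps_X * gS k) * (1 - fps_X + 2 * fps_X * gS k)
      - 8 * fps_X * fps_X * (fps_const (real k + 1) + gS k * gS k)"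
    unfolding disc_poly_def power2_eq_square[of "[:1, -1:] + monom (2 * c) (2 * k + 1)"]
      fps_of_poly_diff fps_of_poly_mult fps_of_poly_add m1 m2 p1 p2 p3 ..
  define W where "W = fps_X * (fps_const (real k + 1) + (gR k - gS k) * (gR k - gS k) + gR k * gR k + gR k)"
  have "(1 - gT k) * (1 - gT k) - fps_of_poly (disc_poly k c) = 8 * fps_X * (W - gR k)"
    unfolding D gT_def W_def by (simp add: algebra_simps)
  also have "W = gR k" unfolding W_def by (rule gR_eq[symmetric])
  finally show ?thesis by (simp add: c_def)
qed

text \<open>Elimination of G from E (X + z) = A + z G and G (X + 2zN) = B + 2zN E, where X = 1 - T.
  The determinant (X + z)(X + 2zN) - 2 z^2 N factors as X (X + z + 2zN); X carries the singularity,
  and the other factor is 1 - G3 with G3 >= 0.\<close>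

lemma gE_gT:
  defines "A k \<equiv> fps_X * gF k * gF k - 2 * fps_const ((real k)\<^sup>2) * gS k * (fps_X * (gR k - gS k))"
    and "B k \<equiv> fps_const (real k) * fps_X - 2 * fps_const ((real k)\<^sup>2) * gS k * (fps_X * (gR k - gS k))
      + 2 * fps_X * (gF k - fps_const (real k) * gS k) * (gF k - fps_const (real k) * gS k) + 2 * fps_X * gF k * gF k"
    and "G3 k \<equiv> fps_X * (2 * (gR k - gS k) + 2 * (gR k - gN k))"
  shows "gE k * (1 - gT k) * (1 - G3 k) = A k * ((1 - gT k) + 2 * fps_X * gN k) + fps_X * B k"
proof -
  let ?X = "1 - gT k"
  have e: "gE k * (?X + fps_X) = A k + fps_X * gG k"
  proof -
    have "gE k * (?X + fps_X) = gE k - gE k * (fps_X * (2 * (gR k - gS k) + 2 * gR k))"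
      by (simp add: gT_def algebra_simps)
    also have "\<dots> = A k + fps_X * gG k"
      by (subst (1) gE_eq) (simp add: A_def algebra_simps)
    finally show ?thesis .
  qed
  have g: "gG k * (?X + 2 * fps_X * gN k) = B k + 2 * fps_X * gN k * gE k"
  proof -
    have "gG k * (?X + 2 * fps_X * gN k) = gG k - gG k * (fps_X * (2 * (gR k - gS k) + 2 * gR k + 1 - 2 * gN k))"
      by (simp add: gT_def algebra_simps)
    also have "\<dots> = B k + 2 * fps_X * gN k * gE k"
      by (subst (1) gG_eq) (simp add: B_def algebra_simps)
    finally show ?thesis .
  qed
  have G3: "1 - G3 k = ?X + fps_X + 2 * fps_X * gN k" by (simp add: G3_def gT_def algebra_simps)
  have "gE k * (?X + fps_X) * (?X + 2 * fps_X * gN k) = A k * (?X + 2 * fps_X * gN k) + fps_X * (gG k * (?X + 2 * fps_X * gN k))"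
    unfolding e by (simp add: algebra_simps)
  also have "\<dots> = A k * (?X + 2 * fps_X * gN k) + fps_X * B k + 2 * fps_X * fps_X * gN k * gE k"
    unfolding g by (simp add: algebra_simps)
  finally have "gE k * (?X + fps_X) * (?X + 2 * fps_X * gN k) - 2 * fps_X * fps_X * gN k * gE k
    = A k * (?X + 2 * fps_X * gN k) + fps_X * B k" by simp
  moreover have "gE k * (?X + fps_X) * (?X + 2 * fps_X * gN k) - 2 * fps_X * fps_X * gN k * gE k
     = gE k * ?X * (1 - G3 k)" unfolding G3 by (simp add: algebra_simps)
  ultimately show ?thesis by simp
qed

lemma mult_inverse_fps_eq:
  fixes A G C :: "real fps"
  assumes "A * (1 - G) = C" "G $ 0 = 0"
  shows "A = C * inverse (1 - G)"
proof -
  have "(1 - G) * inverse (1 - G) = 1" by (rule inverse_mult_eq_1') (simp add: assms)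
  then have "A = A * ((1 - G) * inverse (1 - G))" by simp
  then show ?thesis by (simp only: assms(1) mult.assoc[symmetric])
qed

text \<open>The common form of the equations for N, F and E X: linear, with a nonnegative G whose
  value at r is below 1.\<close>

lemma tame_solution:
  fixes A G C :: "real fps"
  assumes "A * (1 - G) = C" "tame r C" "tame r G" "\<And>n. G $ n \<ge> 0" "G $ 0 = 0" "r > 0" "ev r G < 1"
  shows "tame r A" "ev r A = ev r C / (1 - ev r G)"
proof -
  show A: "tame r A"
    unfolding mult_inverse_fps_eq[OF assms(1,5)]
    by (intro tame_mult tame_inverse_one_minus assms)
  have "ev r A * (1 - ev r G) = ev r C"
    unfolding assms(1)[symmetric] using A assms(3) by (simp add: ev_simps tame_diff)
  then show "ev r A = ev r C / (1 - ev r G)" using assms(7) by (simp add: field_simps)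
qed

text \<open>The series are evaluated at r in the order S, zR, N, F, A, B, E X. The facts on r and s
  are exported because \<open>lam_of_tendsto\<close> uses them for all k.\<close>

lemma ratio_asymp:
  assumes k: "k \<ge> 2"
  obtains r s where "0 < r" "r\<^sup>2 \<le> 1 / (8 * (real k + 1))" "0 \<le> s" "(2 * real k + 1) * s \<le> (1 / 2) ^ k"
    "(1 - r + 2 * r * s)\<^sup>2 = 8 * r\<^sup>2 * (real k + 1 + s\<^sup>2)"
    "(\<lambda>n. real (t_count k n) / real (r_count k n)) \<sim>[at_top] (\<lambda>n. lam_of (real k) r s * real n)"
proof -
  define c where "c = real (card (sigma_stars k))"
  have "c \<le> real (2 ^ (2 * k - 1) * fact k)" unfolding c_def using card_sigma_stars(2) by (rule of_nat_mono)
  then have c: "c \<ge> 0" "c \<le> 2 ^ (2 * k - 1) * fact k" by (simp_all add: c_def)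
  obtain r where r: "r > 0" "r\<^sup>2 \<le> 1 / (8 * (real k + 1))" "poly (disc_poly k c) r = 0"
    and pos: "\<And>x. 0 \<le> x \<Longrightarrow> x < r \<Longrightarrow> poly (disc_poly k c) x > 0"
    and simple: "poly (pderiv (disc_poly k c)) r < 0"
    and sb: "(2 * real k + 1) * (c * r ^ (2 * k)) \<le> (1 / 2) ^ k" "c * r ^ (2 * k) \<le> r / 2"
    using disc_poly_root[OF k c] by metis
  define s where "s = c * r ^ (2 * k)"
  define K where "K = real k"
  have K: "K \<ge> 2" using k by (simp add: K_def)
  have s: "0 \<le> s" "s \<le> r / 2" using c r sb by (auto simp: s_def)
  have half: "(1 / 2 :: real) ^ k \<le> 1 / 4"
    using power_decreasing[OF k, of "1/2 :: real"] by (simp add: power2_eq_square)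
  have sK: "(2 * K + 1) * s \<le> 1 / 4" using sb(1) half unfolding K_def s_def by linarith
  have sK2: "K\<^sup>2 * s \<le> 1 / 4"
  proof -
    have "K * (1/2) ^ k \<le> 1 / 2"
      using k unfolding K_def
    proof (induction k rule: dec_induct)
      case (step m)
      have "real (Suc m) * (1/2) ^ Suc m = (real (Suc m) / 2) * (1/2) ^ m" by simp
      also have "\<dots> \<le> real m * (1/2) ^ m" using step by (intro mult_right_mono) auto
      also have "\<dots> \<le> 1 / 2" by (rule step)
      finally show ?case .
    qed (simp add: power2_eq_square)
    \<comment> \<open>The bound follows from 2 K^2 s <= K (2K + 1) s <= K / 2^k <= 1/2.\<close>
    moreover have "K * ((2 * K + 1) * s) \<le> K * (1/2) ^ k"
      using sb(1) K unfolding K_def s_def by (intro mult_left_mono) auto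
    moreover have "K * ((2 * K + 1) * s) = 2 * (K\<^sup>2 * s) + K * s" by (simp add: power2_eq_square algebra_simps)
    moreover have "0 \<le> K * s" using K s by simp
    ultimately show ?thesis by linarith
  qed
  have lam_pos: "lam_of K r s > 0"
    using lam_of_pos[OF K r(1) _ s sK sK2] r(2) by (simp add: K_def)

  let ?X = "fps_X :: real fps"
  let ?K = "fps_const K"
  let ?R = "gR k" and ?S = "gS k" and ?N = "gN k" and ?F = "gF k" and ?E = "gE k" and ?T = "gT k"
  define U where "U = ?X * ?R"
  define V where "V = ?X * (?R - ?S)"
  have T0: "?T $ 0 = 0" by (simp add: gT_def)
  have "(?X * (2 * (?R - ?S) + 2 * ?R + 1)) $ 1 = 2 * (?R - ?S) $ 0 + 2 * ?R $ 0 + 1"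
    by (simp add: two_times_nth)
  then have T1: "?T $ 1 > 0"
    using gf_nonneg_all(1,2)[of k 0] unfolding gT_def by linarith
  note sing = sqrt_singularity[OF r(1) gT_nonneg[of k] T0 T1 gT_square[of k, folded c_def] pos r(3) less_imp_neq[OF simple]]
  obtain v where v: "v \<noteq> 0"
    "\<And>H. tame r H \<Longrightarrow> (\<lambda>n. (H * inverse (1 - ?T)) $ n * r ^ n * sqrt n) \<longlonglongrightarrow> ev r H * v"
    "(\<lambda>n. real n * (?T $ n * r ^ n) * sqrt n) \<longlonglongrightarrow> - r * poly (pderiv (disc_poly k c)) r / 2 * v"
    using sing(3) by blast

  have S_eq: "?S = fps_const c * ?X ^ (2 * k)" by (simp add: gS_def gf_sigma_stars c_def)
  have tS: "tame r ?S" unfolding S_eq by (intro tame_intros)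
  have eS: "ev r ?S = s" unfolding S_eq s_def by (simp add: ev_simps tame_intros)
  \<comment> \<open>T is affine in zR, so tameness and value of zR are read off from those of T and
    S.\<close>
  have U_eq: "U = fps_const (1/4) * (?T - ?X + 2 * ?X * ?S)"
  proof -
    have "?T - ?X + 2 * ?X * ?S = fps_const 4 * U"
      by (simp add: gT_def U_def algebra_simps flip: numeral_fps_const)
    then have "fps_const (1/4) * (?T - ?X + 2 * ?X * ?S) = (fps_const (1/4) * fps_const 4) * U"
      by (simp only: mult.assoc)
    then show ?thesis by simp
  qed
  define m where "m = (1 - r + 2 * r * s) / 4"
  define w where "w = m - r * s"
  have tU: "tame r U" unfolding U_eq by (intro tame_intros sing(1) tS)
  have eU: "ev r U = m"
    unfolding U_eq m_def by (simp add: ev_simps tame_intros sing(1,2) tS eS)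
  have V_eq: "V = U - ?X * ?S" by (simp add: U_def V_def algebra_simps)
  have tV: "tame r V" unfolding V_eq by (intro tame_intros tU tS)
  have eV: "ev r V = w" unfolding V_eq w_def by (simp add: ev_simps tame_intros tU eU tS eS)
  have s4: "s \<le> 1 / 4"
  proof -
    have "1 * s \<le> (2 * K + 1) * s" using s K by (intro mult_right_mono) auto
    then show ?thesis using sK by simp
  qed
  have "r * s \<le> r * (1 / 4)" using s4 r by (intro mult_left_mono) auto
  then have "4 * (r * s) \<le> r" by simp
  moreover have "4 * m = 1 - r + 2 * (r * s)" by (simp add: m_def)
  ultimately have m: "2 * m < 1" using r(1) by linarith

  define n where "n = K * r / (1 - 2 * m)"
  have eqN: "?N * (1 - 2 * U) = ?K * ?X"
  proof -
    have "?N * (1 - 2 * U) = ?N - ?N * (2 * U)" by (simp add: algebra_simps)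
    also have "\<dots> = ?K * ?X" by (subst (1) gN_eq) (simp add: U_def K_def algebra_simps)
    finally show ?thesis .
  qed
  have U_nonneg: "(2 * U) $ i \<ge> 0" for i
    unfolding two_times_nth U_def using fps_nth_X_mult_nonneg[OF gf_nonneg_all(1)] by simp
  have t2U: "tame r (2 * U)" by (intro tame_intros tU)
  have e2U: "ev r (2 * U) = 2 * m" by (simp add: ev_simps tU eU)
  have U0: "(2 * U) $ 0 = 0" by (simp add: U_def two_times_nth)
  have tKX: "tame r (?K * ?X)" by (intro tame_intros)
  note N = tame_solution[OF eqN tKX t2U U_nonneg U0 r(1) m[folded e2U]]
  note tN = N(1)
  have eN: "ev r ?N = n" unfolding N(2) e2U n_def by (simp add: ev_simps)
  have n: "n > 0" unfolding n_def using K r m by simp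

  define f where "f = (K * r - 2 * K * s * w) / (r * n)"
  \<comment> \<open>Two forms of G2 are used: through R - S and R - N its coefficients are visibly
    nonnegative, while T - zN with T(r) = 1 gives the value 1 - r n < 1. G3 is treated
    likewise.\<close>
  define G2 where "G2 = ?T - ?X * ?N"
  have G2_eq: "G2 = ?X * (2 * (?R - ?S) + ?R + (?R - ?N) + 1)"
    by (simp add: G2_def gT_def algebra_simps)
  have G2_nonneg: "G2 $ i \<ge> 0" for i
    unfolding G2_eq
  proof (rule fps_nth_X_mult_nonneg)
    fix j
    show "(2 * (?R - ?S) + ?R + (?R - ?N) + 1) $ j \<ge> 0"
      unfolding fps_add_nth two_times_nth using gf_nonneg_all[of k j] by (simp del: fps_sub_nth)
  qed
  have G2_0: "G2 $ 0 = 0" by (simp add: G2_eq)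
  have tG2: "tame r G2" unfolding G2_def by (intro tame_intros sing(1) tN)
  have eG2: "ev r G2 = 1 - r * n" unfolding G2_def by (simp add: ev_simps tame_intros sing(1,2) tN eN)
  have eqF: "?F * (1 - G2) = ?K * ?X - 2 * ?K * ?S * V"
  proof -
    have "?F * (1 - G2) = ?F - ?F * G2" by (simp add: algebra_simps)
    also have "\<dots> = ?K * ?X - 2 * ?K * ?S * V"
      by (subst (1) gF_eq) (simp add: G2_eq V_def K_def algebra_simps)
    finally show ?thesis .
  qed
  have eG2': "ev r G2 < 1" unfolding eG2 using r n by simp
  have tCF: "tame r (?K * ?X - 2 * ?K * ?S * V)" by (intro tame_intros tS tV)
  note F = tame_solution[OF eqF tCF tG2 G2_nonneg G2_0 r(1) eG2']
  have eF: "ev r ?F = f"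
    unfolding F(2) eG2 f_def by (simp add: ev_simps tame_intros tS tV eS eV)

  define a where "a = r * f\<^sup>2 - 2 * K\<^sup>2 * s * w"
  define b where "b = K * r - 2 * K\<^sup>2 * s * w + 2 * r * (f - K * s)\<^sup>2 + 2 * r * f\<^sup>2"
  define h where "h = (a * (2 * r * n) + r * b) / (r + 2 * r * n)"
  define A where "A = ?X * ?F * ?F - 2 * fps_const (K\<^sup>2) * ?S * V"
  define B where "B = ?K * ?X - 2 * fps_const (K\<^sup>2) * ?S * V
    + 2 * ?X * (?F - ?K * ?S) * (?F - ?K * ?S) + 2 * ?X * ?F * ?F"
  define G3 where "G3 = ?X * (2 * (?R - ?S) + 2 * (?R - ?N))"
  define H where "H = ?E * (1 - ?T)"
  have tA: "tame r A" unfolding A_def by (intro tame_intros F(1) tS tV)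
  have eA: "ev r A = a"
    unfolding A_def a_def by (simp add: ev_simps tame_intros F(1) tS tV eF eS eV power2_eq_square)
  have tB: "tame r B" unfolding B_def by (intro tame_intros F(1) tS tV)
  have eB: "ev r B = b"
    unfolding B_def b_def by (simp add: ev_simps tame_intros F(1) tS tV eF eS eV power2_eq_square)
  have G3_nonneg: "G3 $ i \<ge> 0" for i
    unfolding G3_def
  proof (rule fps_nth_X_mult_nonneg)
    fix j
    show "(2 * (?R - ?S) + 2 * (?R - ?N)) $ j \<ge> 0"
      unfolding fps_add_nth two_times_nth using gf_nonneg_all[of k j] by (simp del: fps_sub_nth)
  qed
  have G3_0: "G3 $ 0 = 0" by (simp add: G3_def)
  have G3_eq: "G3 = ?T - ?X - 2 * ?X * ?N" by (simp add: G3_def gT_def algebra_simps)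
  have tG3: "tame r G3" unfolding G3_eq by (intro tame_intros sing(1) tN)
  have eG3: "ev r G3 = 1 - (r + 2 * r * n)"
    unfolding G3_eq by (simp add: ev_simps tame_intros sing(1,2) tN eN)
  have "0 < r + 2 * r * n" using r n by (intro add_pos_pos) auto
  then have eG3': "ev r G3 < 1" unfolding eG3 by simp
  have eqH: "H * (1 - G3) = A * ((1 - ?T) + 2 * ?X * ?N) + ?X * B"
    unfolding H_def A_def B_def G3_def V_def K_def by (rule gE_gT)
  have tCH: "tame r (A * ((1 - ?T) + 2 * ?X * ?N) + ?X * B)"
    by (intro tame_intros tA tB tN sing(1))
  note H = tame_solution[OF eqH tCH tG3 G3_nonneg G3_0 r(1) eG3']
  have eH: "ev r H = h"
    unfolding H(2) eG3 h_def by (simp add: ev_simps tame_intros tA tB tN sing(1,2) eA eB eN)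
  have E_eq: "?E = H * inverse (1 - ?T)"
    by (rule mult_inverse_fps_eq[OF _ T0]) (simp add: H_def)
  have limE: "(\<lambda>i. ?E $ i * r ^ i * sqrt i) \<longlonglongrightarrow> h * v"
    unfolding E_eq eH[symmetric] by (rule v(2)[OF H(1)])
  \<comment> \<open>F is tame, so F_i r^i = o(1/i); on the scale i^(-1/2) only E
    contributes.\<close>
  have limF: "(\<lambda>i. ?F $ i * r ^ i * sqrt i) \<longlonglongrightarrow> 0"
  proof -
    have "(\<lambda>i. real i * (?F $ i * r ^ i) * (1 / sqrt i)) \<longlonglongrightarrow> 0 * 0"
      by (intro tendsto_mult tameD(3)[OF F(1)]) real_asymp
    moreover have "\<forall>\<^sub>F i in sequentially. real i * (?F $ i * r ^ i) * (1 / sqrt i) = ?F $ i * r ^ i * sqrt i"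
      using eventually_gt_at_top[of 0]
    proof eventually_elim
      case (elim i)
      have "real i * (1 / sqrt i) = sqrt i" using elim by (simp add: real_div_sqrt)
      moreover have "real i * y * (1 / sqrt i) = y * (real i * (1 / sqrt i))" for y by (simp only: mult_ac)
      ultimately show ?case by (simp only:)
    qed
    ultimately show ?thesis by (auto intro: Lim_transform_eventually)
  qed
  have limt: "(\<lambda>i. real (t_count k i) * r ^ i * sqrt i) \<longlonglongrightarrow> h * v"
    using tendsto_add[OF limF limE] unfolding t_count_eq by (simp add: algebra_simps)

  define d where "d = - poly (pderiv (disc_poly k c)) r"
  have d: "d > 0" using simple by (simp add: d_def)
  \<comment> \<open>S lives in degree 2k alone, so T_(i+1) = 4 R_i for i > 2k. The index shift costs
    a factor r and a ratio tending to 1.\<close>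
  have limr: "(\<lambda>i. real i * real (r_count k i) * r ^ i * sqrt i) \<longlonglongrightarrow> d * v / 8"
  proof -
    have "(\<lambda>i. real (Suc i) * (?T $ Suc i * r ^ Suc i) * sqrt (Suc i)) \<longlonglongrightarrow> r * d / 2 * v"
      using LIMSEQ_Suc[OF v(3)] by (simp add: d_def)
    moreover have "(\<lambda>i. (real i * sqrt i) / ((real i + 1) * sqrt (real i + 1))) \<longlonglongrightarrow> 1"
      by real_asymp
    then have "(\<lambda>i. (real i * sqrt i) / ((real i + 1) * sqrt (real i + 1)) / (4 * r)) \<longlonglongrightarrow> 1 / (4 * r)"
      by (rule tendsto_divide[OF _ tendsto_const]) (use r in simp)
    ultimately have "(\<lambda>i. real (Suc i) * (?T $ Suc i * r ^ Suc i) * sqrt (Suc i) *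
        ((real i * sqrt i) / ((real i + 1) * sqrt (real i + 1)) / (4 * r))) \<longlonglongrightarrow> (r * d / 2 * v) * (1 / (4 * r))"
      by (rule tendsto_mult)
    moreover have "\<forall>\<^sub>F i in sequentially. real (Suc i) * (?T $ Suc i * r ^ Suc i) * sqrt (Suc i) *
        ((real i * sqrt i) / ((real i + 1) * sqrt (real i + 1)) / (4 * r)) = real i * real (r_count k i) * r ^ i * sqrt i"
      using eventually_gt_at_top[of "2 * k"]
    proof eventually_elim
      case (elim i)
      have "?S $ i = 0" using elim by (simp add: S_eq)
      then have T: "?T $ Suc i = 4 * real (r_count k i)"
        using elim unfolding gT_def r_count_eq by (simp add: two_times_nth)
      have "x * (4 * y * (r * z)) * q * ((u * p) / (x * q) / (4 * r)) = u * y * z * p"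
        if "x \<noteq> 0" "q \<noteq> 0" for x y z q u p :: real
        using that r by (simp add: field_simps)
      from this[of "real i + 1" "sqrt (real i + 1)"] show ?case
        unfolding T by (simp add: add.commute)
    qed
    ultimately have "(\<lambda>i. real i * real (r_count k i) * r ^ i * sqrt i) \<longlonglongrightarrow> (r * d / 2 * v) * (1 / (4 * r))"
      by (rule Lim_transform_eventually)
    then show ?thesis using r by simp
  qed
  have lam: "lam_of K r s = 8 * h / d"
  proof -
    have "d = 2 * (1 - r + 2 * r * s) * (1 - 2 * (2 * K + 1) * s) + 16 * r * (K + 1 + s\<^sup>2) + 32 * r * K * s\<^sup>2"
      unfolding d_def K_def poly_pderiv_disc_poly[OF s_def] by simp
    then show ?thesis
      by (simp only: lam_of_def Let_def m_def w_def n_def f_def a_def b_def h_def)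
  qed
  have "(\<lambda>i. (real (t_count k i) * r ^ i * sqrt i) / (real i * real (r_count k i) * r ^ i * sqrt i)) \<longlonglongrightarrow> (h * v) / (d * v / 8)"
    using d v(1) by (intro tendsto_divide limt limr) auto
  then have "(\<lambda>i. (real (t_count k i) * r ^ i * sqrt i) / (real i * real (r_count k i) * r ^ i * sqrt i) * (1 / lam_of K r s)) \<longlonglongrightarrow>
      (h * v) / (d * v / 8) * (1 / lam_of K r s)"
    by (intro tendsto_mult tendsto_const)
  moreover have "(h * v) / (d * v / 8) * (1 / lam_of K r s) = 1"
    using lam_pos v(1) d unfolding lam by (simp add: field_simps)
  moreover have "\<forall>\<^sub>F i in sequentially. (real (t_count k i) * r ^ i * sqrt i) / (real i * real (r_count k i) * r ^ i * sqrt i) * (1 / lam_of K r s)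
      = (real (t_count k i) / real (r_count k i)) / (lam_of K r s * real i)"
    using eventually_gt_at_top[of 0] by eventually_elim (use r in \<open>simp add: mult_ac\<close>)
  ultimately have "(\<lambda>i. (real (t_count k i) / real (r_count k i)) / (lam_of K r s * real i)) \<longlonglongrightarrow> 1"
    by (auto intro: Lim_transform_eventually)
  then have "(\<lambda>n. real (t_count k n) / real (r_count k n)) \<sim>[at_top] (\<lambda>n. lam_of K r s * real n)"
    by (rule asymp_equivI')
  moreover have "(1 - r + 2 * r * s)\<^sup>2 = 8 * r\<^sup>2 * (real k + 1 + s\<^sup>2)"
    using r(3) unfolding poly_disc_poly s_def[symmetric] by simp
  ultimately show ?thesis
    using that[of r s] r(1,2) s(1) sb(1)[folded s_def] unfolding K_def by blast
qed

theorem theorem7: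
  shows "\<exists>lam :: nat \<Rightarrow> real.
    (\<forall>k \<ge> 2. (\<lambda>n. real (t_count k n) / real (r_count k n)) \<sim>[at_top] (\<lambda>n. lam k * real n))
    \<and> (lam \<longlonglongrightarrow> 1)"
proof -
  \<comment> \<open>r and s are bundled into a pair so that a single choice function over k provides
    both.\<close>
  define P where "P = (\<lambda>k p. 0 < fst p \<and> (fst p)\<^sup>2 \<le> 1 / (8 * (real k + 1)) \<and> 0 \<le> snd p \<and> (2 * real k + 1) * snd p \<le> (1 / 2) ^ k
    \<and> (1 - fst p + 2 * fst p * snd p)\<^sup>2 = 8 * (fst p)\<^sup>2 * (real k + 1 + (snd p)\<^sup>2)
    \<and> (\<lambda>n. real (t_count k n) / real (r_count k n)) \<sim>[at_top] (\<lambda>n. lam_of (real k) (fst p) (snd p) * real n))"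
  have "\<exists>p. P k p" if k: "k \<ge> 2" for k
  proof -
    obtain r s where "0 < r" "r\<^sup>2 \<le> 1 / (8 * (real k + 1))" "0 \<le> s" "(2 * real k + 1) * s \<le> (1 / 2) ^ k"
      "(1 - r + 2 * r * s)\<^sup>2 = 8 * r\<^sup>2 * (real k + 1 + s\<^sup>2)"
      "(\<lambda>n. real (t_count k n) / real (r_count k n)) \<sim>[at_top] (\<lambda>n. lam_of (real k) r s * real n)"
      using ratio_asymp[OF k] .
    then have "P k (r, s)" unfolding P_def fst_conv snd_conv by blast
    then show ?thesis ..
  qed
  then obtain p where p: "\<And>k. k \<ge> 2 \<Longrightarrow> P k (p k)" by metis
  have "(\<lambda>k. lam_of (real k) (fst (p k)) (snd (p k))) \<longlonglongrightarrow> 1"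
    by (rule lam_of_tendsto) (use p in \<open>simp_all add: P_def\<close>)
  moreover have "(\<lambda>n. real (t_count k n) / real (r_count k n)) \<sim>[at_top]
      (\<lambda>n. lam_of (real k) (fst (p k)) (snd (p k)) * real n)" if "k \<ge> 2" for k
    using p[OF that] unfolding P_def by blast
  ultimately show ?thesis by (intro exI[of _ "\<lambda>k. lam_of (real k) (fst (p k)) (snd (p k))"]) blast
qed

end
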